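(* For every integer $r\ge 2$, $\mathrm{egd}(G_r)=r$. Moreover, $G_r$ is a minimal forbidden minor for the class $\mathcal{G}_{r-1}$.
   Context: All graphs are finite and simple. Notation: $[n]=\{1,\dots,n\}$; $X\succeq 0$ means $X$ is a real symmetric positive semidefinite matrix. Extreme Gram dimension: for a graph $G=([n],E)$, $\mathrm{egd}(G)$ is the smallest integer $r\ge 1$ such that for every $w\in\mathbb{R}^E$ the semidefinite program $\max\ \sum_{ij\in E}w_{ij}X_{ij}$ subject to $X_{ii}=1$ $(i\in[n])$, $X\succeq 0$ ($X$ an $n\times n$ symmetric matrix) has an optimal solution of rank at most $r$. For an integer $r\ge 1$, $\mathcal{G}_r$ is the class of graphs $G$ with $\mathrm{egd}(G)\le r$; it is closed under taking minors. A graph is a minimal forbidden minor for a minor-closed class if it does not belong to the class but all its proper minors do (minors are obtained by edge deletions, edge contractions and node deletions). For $r\ge 2$ the graph $G_r$ is the edge graph of the triangulation of an equilateral triangle obtained by subdividing each side into $r-1$ equal segments and drawing through the division points the line segments parallel to the sides, giving $(r-1)^2$ congruent equilateral triangles. Explicitly, $G_r$ has the $\binom{r+1}{2}$ nodes $v_{i,l}$ with $l\in[r]$ and $i\in[r-l+1]$, and its edges are exactly $\{v_{i,l},v_{i+1,l}\}$, $\{v_{i,l},v_{i,l+1}\}$ and $\{v_{i+1,l},v_{i,l+1}\}$ for $l\in[r-1]$, $i\in[r-l]$. *)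

theory Defs
  imports Complex_Main "HOL-Library.Function_Algebras"
begin

section \<open>Finite simple graphs and minors\<close>

record 'a graph =
  nodes :: "'a set"
  edges :: "'a set set"

definition simple_graph :: "'a graph \<Rightarrow> bool" where
  "simple_graph G \<longleftrightarrow> finite (nodes G) \<and> (\<forall>e\<in>edges G. e \<subseteq> nodes G \<and> card e = 2)"

definition delete_edge :: "'a set \<Rightarrow> 'a graph \<Rightarrow> 'a graph" where
  "delete_edge e G = \<lparr>nodes = nodes G, edges = edges G - {e}\<rparr>"

definition delete_node :: "'a \<Rightarrow> 'a graph \<Rightarrow> 'a graph" where
  "delete_node v G = \<lparr>nodes = nodes G - {v}, edges = {e \<in> edges G. v \<notin> e}\<rparr>"

text \<open>Contraction of the edge \<open>{u, v}\<close>: the merged node keeps the name \<open>u\<close>. Loops are discarded,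
  and parallel edges are merged because edges form a set.\<close>

definition contract_edge :: "'a \<Rightarrow> 'a \<Rightarrow> 'a graph \<Rightarrow> 'a graph" where
  "contract_edge u v G =
    \<lparr>nodes = nodes G - {v},
     edges = {e \<in> edges G. v \<notin> e} \<union> {{u, x} | x. {v, x} \<in> edges G \<and> x \<noteq> u}\<rparr>"

inductive minor_step :: "'a graph \<Rightarrow> 'a graph \<Rightarrow> bool" where
  edge_deletion: "e \<in> edges G \<Longrightarrow> minor_step G (delete_edge e G)"
| node_deletion: "v \<in> nodes G \<Longrightarrow> minor_step G (delete_node v G)"
| edge_contraction: "{u, v} \<in> edges G \<Longrightarrow> minor_step G (contract_edge u v G)"

text \<open>Every step removes a node or an edge of a simple graph, so the proper minors are exactly the
  graphs reached by at least one step. All notions below are invariant under graph isomorphism,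
  hence minors need not be closed under renaming of nodes.\<close>

definition proper_minor :: "'a graph \<Rightarrow> 'a graph \<Rightarrow> bool" where
  "proper_minor H G \<longleftrightarrow> minor_step\<^sup>+\<^sup>+ G H"

definition minimal_forbidden_minor :: "'a graph set \<Rightarrow> 'a graph \<Rightarrow> bool" where
  "minimal_forbidden_minor \<G> G \<longleftrightarrow>
    simple_graph G \<and> G \<notin> \<G> \<and> (\<forall>H. proper_minor H G \<longrightarrow> H \<in> \<G>)"

section \<open>Matrices indexed by a finite set\<close>

text \<open>A real matrix with rows and columns indexed by a finite set \<open>V\<close> is a function
  \<open>X :: 'a \<Rightarrow> 'a \<Rightarrow> real\<close>, of which only the values on \<open>V \<times> V\<close> matter.\<close>

definition psd :: "'a set \<Rightarrow> ('a \<Rightarrow> 'a \<Rightarrow> real) \<Rightarrow> bool" where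
  "psd V X \<longleftrightarrow> (\<forall>i\<in>V. \<forall>j\<in>V. X i j = X j i) \<and>
    (\<forall>x :: 'a \<Rightarrow> real. 0 \<le> (\<Sum>i\<in>V. \<Sum>j\<in>V. x i * X i j * x j))"

interpretation fun_space: vector_space "\<lambda>(c::real) (f :: 'a \<Rightarrow> real) x. c * f x"
  by unfold_locales (auto simp: fun_eq_iff algebra_simps)

text \<open>The rank is the dimension of the column space; columns are extended by \<open>0\<close> outside \<open>V\<close>.\<close>

definition matrix_rank :: "'a set \<Rightarrow> ('a \<Rightarrow> 'a \<Rightarrow> real) \<Rightarrow> nat" where
  "matrix_rank V X = fun_space.dim ((\<lambda>j i. if i \<in> V then X i j else 0) ` V)"

section \<open>Extreme Gram dimension\<close>

definition sdp_feasible :: "'a graph \<Rightarrow> ('a \<Rightarrow> 'a \<Rightarrow> real) \<Rightarrow> bool" where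
  "sdp_feasible G X \<longleftrightarrow> psd (nodes G) X \<and> (\<forall>i\<in>nodes G. X i i = 1)"

text \<open>The sum runs over ordered pairs of adjacent nodes, so it counts every edge twice.\<close>

definition sdp_objective :: "'a graph \<Rightarrow> ('a set \<Rightarrow> real) \<Rightarrow> ('a \<Rightarrow> 'a \<Rightarrow> real) \<Rightarrow> real" where
  "sdp_objective G w X = (\<Sum>(i, j) | {i, j} \<in> edges G. w {i, j} * X i j) / 2"

definition sdp_optimal :: "'a graph \<Rightarrow> ('a set \<Rightarrow> real) \<Rightarrow> ('a \<Rightarrow> 'a \<Rightarrow> real) \<Rightarrow> bool" where
  "sdp_optimal G w X \<longleftrightarrow> sdp_feasible G X \<and>
    (\<forall>Y. sdp_feasible G Y \<longrightarrow> sdp_objective G w Y \<le> sdp_objective G w X)"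

definition egd :: "'a graph \<Rightarrow> nat" where
  "egd G = (LEAST r. 1 \<le> r \<and>
    (\<forall>w. \<exists>X. sdp_optimal G w X \<and> matrix_rank (nodes G) X \<le> r))"

definition egd_class :: "nat \<Rightarrow> 'a graph set" where
  "egd_class r = {G. simple_graph G \<and> egd G \<le> r}"

section \<open>The triangular grid graph\<close>

text \<open>The node \<open>v\<^sub>i\<^sub>,\<^sub>l\<close> is the pair \<open>(i, l)\<close>.\<close>

definition tri_graph :: "nat \<Rightarrow> (nat \<times> nat) graph" where
  "tri_graph r =
    \<lparr>nodes = {(i, l). l \<in> {1..r} \<and> i \<in> {1..r - l + 1}},
     edges = (\<Union>l\<in>{1..r - 1}. \<Union>i\<in>{1..r - l}.
       {{(i, l), (i + 1, l)}, {(i, l), (i, l + 1)}, {(i + 1, l), (i, l + 1)}})\<rparr>"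

end

theory Submission
  imports Defs "HOL-Analysis.Function_Topology"
begin

text \<open>
  The lower bound comes from an objective whose optima are rigid. Assign orthonormal vectors to the
  bottom row of the grid, and to every higher node the normalised sum of the vectors of the two nodes
  below it. Each upward triangle gives a linear relation between three Gram vectors with fixed
  coefficients. The sum of the squared norms of these relations only involves diagonal entries and
  edges, so up to a constant it is the negative of an objective, and every optimum satisfies all
  relations (\<open>tri_graph_rigid_objective\<close>). The unit norms of the higher nodes then force the bottom row to
  be orthonormal (\<open>triangle_relations_force_orthogonality\<close>), hence the rank to be at least \<open>r\<close>.

  The upper bounds come from layouts: every node occupies an interval of levels, adjacent nodes occupy
  equal or consecutive levels, and no level holds more than \<open>k\<close> nodes. Such a graph has extreme Gram
  dimension at most \<open>k\<close> (\<open>interval_layout_low_rank\<close>). To see this, sweep over the levels. Suppose that the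
  Gram vectors of the nodes \<open>A\<close> swept so far have rank at most \<open>k\<close>, and let \<open>B\<close> be the next level. If neither
  \<open>A\<close> nor \<open>B\<close> spans the vectors of \<open>A \<union> B\<close>, this span contains unit vectors \<open>f\<close> orthogonal to \<open>A\<close> and \<open>g\<close>
  orthogonal to \<open>B\<close>. Adding a multiple of \<open>f g\<^sup>T + g f\<^sup>T\<close> to the Gram operator changes only
  inner products between \<open>A\<close> and \<open>B\<close>; for one choice of sign the objective does not decrease, and the extreme
  admissible multiple lowers the rank (\<open>cross_update_lowers_rank\<close>). Finally \<open>A\<close> or \<open>B\<close> spans, and the rank is
  at most \<open>k\<close>. The nodes of higher levels are glued on along \<open>B\<close> (\<open>psd_glue\<close>), where nothing has changed.

  Layouts are inherited by minors, because the union of two touching intervals is an interval. The rows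
  of the grid form a layout with \<open>k = r\<close>. For the minimality it remains to find layouts with \<open>k = r - 1\<close> after
  one edge has been deleted or contracted. They are obtained by bending the rows around a node of the
  bottom row: this leaves a single level with \<open>r\<close> nodes, and the missing or contracted edge is
  used to relieve it (\<open>layout_delete_diagonal\<close>, \<open>layout_contract_row\<close>). The rotation of the triangle reduces
  all edges to one direction.
\<close>

section \<open>Bilinear forms of real matrices\<close>

definition form :: "'a set \<Rightarrow> ('a \<Rightarrow> 'a \<Rightarrow> real) \<Rightarrow> ('a \<Rightarrow> real) \<Rightarrow> ('a \<Rightarrow> real) \<Rightarrow> real" where
  "form V X x y = (\<Sum>i\<in>V. \<Sum>j\<in>V. x i * X i j * y j)"

definition supported :: "'a set \<Rightarrow> ('a \<Rightarrow> real) \<Rightarrow> bool" where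
  "supported S x \<longleftrightarrow> (\<forall>i. i \<notin> S \<longrightarrow> x i = 0)"

lemma form_linear [simp]:
  "form V X (\<lambda>i. x i + y i) z = form V X x z + form V X y z"
  "form V X z (\<lambda>i. x i + y i) = form V X z x + form V X z y"
  "form V X (\<lambda>i. x i - y i) z = form V X x z - form V X y z"
  "form V X z (\<lambda>i. x i - y i) = form V X z x - form V X z y"
  "form V X (\<lambda>i. a * x i) z = a * form V X x z"
  "form V X z (\<lambda>i. a * x i) = a * form V X z x"
  "form V X (\<lambda>i. 0) z = 0"
  "form V X z (\<lambda>i. 0) = 0"
  by (simp_all add: form_def algebra_simps sum.distrib sum_subtractf sum_distrib_left)

lemma form_sum:
  assumes "finite I"
  shows "form V X (\<lambda>i. \<Sum>k\<in>I. c k * x k i) z = (\<Sum>k\<in>I. c k * form V X (x k) z)"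
    and "form V X z (\<lambda>i. \<Sum>k\<in>I. c k * x k i) = (\<Sum>k\<in>I. c k * form V X z (x k))"
  using assms by (induction I rule: finite_induct) simp_all

lemma form_cong:
  assumes "\<And>i j. i \<in> V \<Longrightarrow> j \<in> V \<Longrightarrow> X i j = Y i j"
  shows "form V X x y = form V Y x y"
  using assms by (simp add: form_def)

lemma form_restrict:
  assumes "finite V" "S \<subseteq> V" "supported S x" "supported S y"
  shows "form V X x y = form S X x y"
proof -
  have "form V X x y = (\<Sum>i\<in>V. \<Sum>j\<in>S. x i * X i j * y j)"
    unfolding form_def using assms
    by (intro sum.cong refl sum.mono_neutral_right) (auto simp: supported_def)
  also have "\<dots> = form S X x y"
    unfolding form_def using assms
    by (intro sum.mono_neutral_right) (auto simp: supported_def)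
  finally show ?thesis .
qed

lemma form_unit_left:
  assumes "finite V" "i \<in> V"
  shows "form V X (\<lambda>k. of_bool (k = i)) y = (\<Sum>j\<in>V. X i j * y j)"
proof -
  have "form V X (\<lambda>k. of_bool (k = i)) y = (\<Sum>k\<in>V. if k = i then \<Sum>j\<in>V. X i j * y j else 0)"
    unfolding form_def by (intro sum.cong) auto
  then show ?thesis using assms by simp
qed

lemma form_unit:
  assumes "finite V" "i \<in> V" "j \<in> V"
  shows "form V X (\<lambda>k. of_bool (k = i)) (\<lambda>k. of_bool (k = j)) = X i j"
proof -
  have "(\<Sum>k\<in>V. X i k * of_bool (k = j)) = (\<Sum>k\<in>V. if k = j then X i j else 0)"
    by (intro sum.cong) auto
  then show ?thesis using assms by (simp add: form_unit_left)
qed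

lemma psd_form_nonneg: "psd V X \<Longrightarrow> 0 \<le> form V X x x"
  by (simp add: psd_def form_def)

lemma psd_form_commute:
  assumes "psd V X"
  shows "form V X x y = form V X y x"
proof -
  have "form V X x y = (\<Sum>j\<in>V. \<Sum>i\<in>V. x i * X i j * y j)"
    unfolding form_def by (rule sum.swap)
  also have "\<dots> = form V X y x"
    unfolding form_def using assms by (intro sum.cong refl) (auto simp: psd_def)
  finally show ?thesis .
qed

lemma psd_restrict:
  assumes "psd V X" "S \<subseteq> V" "finite V"
  shows "psd S X"
  unfolding psd_def
proof (intro conjI ballI allI)
  fix i j assume "i \<in> S" "j \<in> S"
  then show "X i j = X j i" using assms by (auto simp: psd_def)
next
  fix x :: "'a \<Rightarrow> real"
  let ?x = "\<lambda>i. if i \<in> S then x i else 0"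
  have "0 \<le> form V X ?x ?x" using assms by (rule_tac psd_form_nonneg)
  also have "\<dots> = form S X ?x ?x"
    using assms by (intro form_restrict) (auto simp: supported_def)
  finally show "0 \<le> (\<Sum>i\<in>S. \<Sum>j\<in>S. x i * X i j * x j)"
    by (simp add: form_def)
qed

text \<open>The Cauchy-Schwarz inequality in its degenerate case: otherwise \<open>y + t x\<close> would have negative
  norm for a suitable \<open>t\<close>.\<close>

lemma psd_isotropic_in_kernel:
  assumes "psd V X" "form V X x x = 0"
  shows "form V X x y = 0" "form V X y x = 0"
proof -
  define b where "b = form V X x y"
  have b: "form V X y x = b" unfolding b_def by (rule psd_form_commute[OF assms(1)])
  have ineq: "0 \<le> form V X y y + 2 * t * b" for t
    using psd_form_nonneg[OF assms(1), of "\<lambda>i. y i + t * x i"] assms(2) b b_def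
    by (simp add: algebra_simps)
  have "b = 0"
  proof (rule ccontr)
    assume "b \<noteq> 0"
    then show False
      using ineq[of "- (form V X y y + 1) / (2 * b)"] by (simp add: field_simps)
  qed
  then show "form V X x y = 0" "form V X y x = 0" using b b_def by auto
qed

text \<open>The form may be degenerate on the vectors supported on \<open>S\<close>, so the projection is obtained by the
  Gram-Schmidt process, which skips the directions of norm \<open>0\<close>; this takes the place of a pseudo-inverse.\<close>

lemma orthogonal_projection_exists:
  assumes "psd V X" "finite S"
  shows "\<exists>y. supported S y \<and> (\<forall>z. supported S z \<longrightarrow> form V X z (\<lambda>i. x i - y i) = 0)"
  using assms(2)
proof (induction S arbitrary: x rule: finite_induct)
  case empty
  show ?case
  proof (intro exI[of _ "\<lambda>_. 0"] conjI allI impI)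
    fix z :: "'a \<Rightarrow> real" assume "supported {} z"
    then have "z = (\<lambda>_. 0)" by (auto simp: supported_def)
    then show "form V X z (\<lambda>i. x i - 0) = 0" by simp
  qed (simp add: supported_def)
next
  case (insert b S)
  let ?e = "\<lambda>k. of_bool (k = b) :: real"
  obtain p where p: "supported S p" "\<And>z. supported S z \<Longrightarrow> form V X z (\<lambda>i. ?e i - p i) = 0"
    using insert.IH[of ?e] by blast
  obtain y where y: "supported S y" "\<And>z. supported S z \<Longrightarrow> form V X z (\<lambda>i. x i - y i) = 0"
    using insert.IH[of x] by blast
  define n where "n = (\<lambda>i. ?e i - p i)"
  define c where "c = form V X n n"
  define d where "d = form V X n (\<lambda>i. x i - y i)"
  have d0: "d = 0" if "c = 0"
    using psd_isotropic_in_kernel(1)[OF assms(1)] that unfolding c_def d_def by blast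
  \<comment> \<open>If \<open>c = 0\<close>, the quotient is \<open>0\<close> and \<open>n\<close> is skipped.\<close>
  define y' where "y' = (\<lambda>i. y i + d / c * n i)"
  show ?case
  proof (intro exI[of _ y'] conjI allI impI)
    show "supported (insert b S) y'"
      using p(1) y(1) by (auto simp: supported_def y'_def n_def)
  next
    fix z :: "'a \<Rightarrow> real" assume z: "supported (insert b S) z"
    \<comment> \<open>Split off from \<open>z\<close> its component along \<open>n\<close>.\<close>
    define z0 where "z0 = (\<lambda>i. z i - z b * n i)"
    have z0: "supported S z0"
      using z p(1) insert.hyps(2) by (auto simp: supported_def z0_def n_def)
    have zeq: "z = (\<lambda>i. z0 i + z b * n i)" by (simp add: z0_def)
    have x: "(\<lambda>i. x i - y' i) = (\<lambda>i. (x i - y i) - d / c * n i)"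
      by (simp add: y'_def algebra_simps)
    have 1: "form V X z0 (\<lambda>i. x i - y i) = 0" "form V X z0 n = 0"
      using y(2)[OF z0] p(2)[OF z0] by (simp_all add: n_def)
    have 2: "form V X n (\<lambda>i. (x i - y i) - d / c * n i) = 0"
    proof -
      have "form V X n (\<lambda>i. (x i - y i) - d / c * n i) = d - d / c * c"
        by (simp only: form_linear(4)[of V X n "\<lambda>i. x i - y i" "\<lambda>i. d / c * n i"]
            form_linear(6) d_def[symmetric] c_def[symmetric])
      then show ?thesis using d0 by (cases "c = 0") auto
    qed
    have "form V X z (\<lambda>i. x i - y' i) = form V X z0 (\<lambda>i. (x i - y i) - d / c * n i)
        + z b * form V X n (\<lambda>i. (x i - y i) - d / c * n i)"
      unfolding x using zeq form_linear(1)[of V X z0 "\<lambda>i. z b * n i"] form_linear(5)[of V X "z b" n]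
      by metis
    also have "form V X z0 (\<lambda>i. (x i - y i) - d / c * n i) = 0"
      using 1 by (simp only: form_linear(4)[of V X z0 "\<lambda>i. x i - y i" "\<lambda>i. d / c * n i"]
          form_linear(6))
    finally show "form V X z (\<lambda>i. x i - y' i) = 0" using 2 by simp
  qed
qed

text \<open>Gram vectors of \<open>X1\<close> and \<open>X2\<close> can be superimposed along the common part, which has the same Gram
  matrix in both. Concretely, a node of \<open>D\<close> is split into its \<open>X2\<close>-projection \<open>a\<close> to the common part
  and the residue \<open>b\<close>; the projection is measured with \<open>X1\<close>, the residue with \<open>X2\<close>, and residues
  are made orthogonal to \<open>C\<close>. Written as a sum of two pulled back forms, \<open>Y\<close> is positive
  semidefinite for free.\<close>

lemma psd_glue:
  assumes "finite C" "finite D" "psd C X1" "psd D X2"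
    and agree: "\<And>i j. i \<in> C \<inter> D \<Longrightarrow> j \<in> C \<inter> D \<Longrightarrow> X1 i j = X2 i j"
  obtains Y where "psd (C \<union> D) Y"
    "\<And>i j. i \<in> C \<Longrightarrow> j \<in> C \<Longrightarrow> Y i j = X1 i j"
    "\<And>i j. i \<in> D \<Longrightarrow> j \<in> D \<Longrightarrow> Y i j = X2 i j"
proof -
  let ?e = "\<lambda>i k. of_bool (k = i) :: real"
  let ?S = "C \<inter> D"
  have "\<forall>i. \<exists>y. supported ?S y \<and> (\<forall>z. supported ?S z \<longrightarrow> form D X2 z (\<lambda>k. ?e i k - y k) = 0)"
    by (intro allI orthogonal_projection_exists[OF assms(4)]) (simp add: assms(1))
  from choice[OF this] obtain p where p: "\<And>i. supported ?S (p i)"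
    "\<And>i z. supported ?S z \<Longrightarrow> form D X2 z (\<lambda>k. ?e i k - p i k) = 0" by auto
  define a where "a i = (if i \<in> C then ?e i else p i)" for i
  define b where "b i = (if i \<in> C then (\<lambda>_. 0) else (\<lambda>k. ?e i k - p i k))" for i
  define Y where "Y i j = form C X1 (a i) (a j) + form D X2 (b i) (b j)" for i j
  have bD: "b i = (\<lambda>k. ?e i k - a i k)" for i by (auto simp: a_def b_def)
  have aD: "supported ?S (a i)" if "i \<in> D" for i
    using that p(1) by (auto simp: a_def supported_def)
  have orth: "form D X2 z (b i) = 0" if "supported ?S z" for z i
    using that p(2) by (simp add: b_def)
  have orth': "form D X2 (b i) z = 0" if "supported ?S z" for z i
    using orth[OF that, of i] psd_form_commute[OF assms(4), of z "b i"] by simp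
  show thesis
  proof (rule that)
    show "psd (C \<union> D) Y"
      unfolding psd_def
    proof (intro conjI ballI allI)
      fix i j show "Y i j = Y j i"
        unfolding Y_def
        by (intro arg_cong2[of _ _ _ _ "(+)"] psd_form_commute assms)
    next
      fix x :: "'a \<Rightarrow> real"
      let ?V = "C \<union> D"
      have fin: "finite ?V" using assms by simp
      let ?a = "\<lambda>k. \<Sum>i\<in>?V. x i * a i k" and ?b = "\<lambda>k. \<Sum>i\<in>?V. x i * b i k"
      have expand: "form U Z (\<lambda>k. \<Sum>i\<in>?V. x i * c i k) (\<lambda>k. \<Sum>i\<in>?V. x i * c i k)
          = (\<Sum>i\<in>?V. \<Sum>j\<in>?V. x i * form U Z (c i) (c j) * x j)" for U :: "'a set" and Z c
        unfolding form_sum(1)[OF fin] unfolding form_sum(2)[OF fin] sum_distrib_left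
        by (intro sum.cong refl) (simp add: mult_ac)
      have "(\<Sum>i\<in>?V. \<Sum>j\<in>?V. x i * Y i j * x j) = form C X1 ?a ?a + form D X2 ?b ?b"
        unfolding expand Y_def sum.distrib[symmetric]
        by (intro sum.cong refl) (simp add: distrib_left distrib_right)
      then show "0 \<le> (\<Sum>i\<in>?V. \<Sum>j\<in>?V. x i * Y i j * x j)"
        using psd_form_nonneg[OF assms(3), of ?a] psd_form_nonneg[OF assms(4), of ?b] by linarith
    qed
  next
    fix i j assume "i \<in> C" "j \<in> C"
    then show "Y i j = X1 i j"
      using form_unit[OF assms(1)] by (simp add: Y_def a_def b_def)
  next
    fix i j assume ij: "i \<in> D" "j \<in> D"
    have "form C X1 (a i) (a j) = form ?S X1 (a i) (a j)"
      using assms(1) aD ij by (intro form_restrict) auto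
    also have "\<dots> = form ?S X2 (a i) (a j)" by (intro form_cong agree)
    also have "\<dots> = form D X2 (a i) (a j)"
      using assms(2) aD ij by (intro form_restrict[symmetric]) auto
    finally have "Y i j = form D X2 (a i) (a j) + form D X2 (b i) (b j)" by (simp add: Y_def)
    also have "\<dots> = form D X2 (\<lambda>k. a i k + b i k) (\<lambda>k. a j k + b j k)"
      using orth[OF aD[OF ij(1)], of j] orth'[OF aD[OF ij(2)], of i] by simp
    also have "\<dots> = form D X2 (?e i) (?e j)" unfolding bD by (simp only: add_diff_cancel_left' diff_add_cancel add.commute[of _ "_ - _"])
    also have "\<dots> = X2 i j" by (rule form_unit[OF assms(2) ij])
    finally show "Y i j = X2 i j" .
  qed
qed

section \<open>Generating sets and rank\<close>

text \<open>In terms of Gram vectors: those of \<open>S\<close> span those of \<open>V\<close>. Working modulo the kernel of the form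
  avoids choosing a Gram representation.\<close>

definition generates :: "'a set \<Rightarrow> ('a \<Rightarrow> 'a \<Rightarrow> real) \<Rightarrow> 'a set \<Rightarrow> bool" where
  "generates V X S \<longleftrightarrow> (\<forall>x. supported V x \<longrightarrow>
     (\<exists>y. supported S y \<and> form V X (\<lambda>i. x i - y i) (\<lambda>i. x i - y i) = 0))"

lemma psd_isotropic_combination:
  assumes "psd V X" "form V X x x = 0" "form V X y y = 0"
  shows "form V X (\<lambda>i. x i + c * y i) (\<lambda>i. x i + c * y i) = 0"
  using psd_isotropic_in_kernel[OF assms(1,2), of y] assms(2,3) by simp

lemma generates_self: "generates V X V"
  unfolding generates_def
proof (intro allI impI)
  fix x :: "'a \<Rightarrow> real" assume "supported V x"
  then show "\<exists>y. supported V y \<and> form V X (\<lambda>i. x i - y i) (\<lambda>i. x i - y i) = 0"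
    by (intro exI[of _ x]) simp
qed

lemma generates_cong:
  assumes "\<And>i j. i \<in> V \<Longrightarrow> j \<in> V \<Longrightarrow> X i j = Y i j"
  shows "generates V X S \<longleftrightarrow> generates V Y S"
  unfolding generates_def using form_cong[of V X Y] assms by simp

lemma generates_trans:
  assumes "psd V X" "finite V" "S \<subseteq> A" "A \<subseteq> V" "generates A X S" "generates V X A"
  shows "generates V X S"
  unfolding generates_def
proof (intro allI impI)
  fix x :: "'a \<Rightarrow> real" assume x: "supported V x"
  obtain y where y: "supported A y" "form V X (\<lambda>i. x i - y i) (\<lambda>i. x i - y i) = 0"
    using assms(6) x unfolding generates_def by blast
  obtain z where z: "supported S z" "form A X (\<lambda>i. y i - z i) (\<lambda>i. y i - z i) = 0"
    using assms(5) y(1) unfolding generates_def by blast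
  have "supported A (\<lambda>i. y i - z i)" using y(1) z(1) assms(3) by (auto simp: supported_def)
  then have "form V X (\<lambda>i. y i - z i) (\<lambda>i. y i - z i) = 0"
    using z(2) assms(2,4) form_restrict[of V A "\<lambda>i. y i - z i" "\<lambda>i. y i - z i" X] by simp
  from psd_isotropic_combination[OF assms(1) y(2) this, of 1]
  have "form V X (\<lambda>i. x i - z i) (\<lambda>i. x i - z i) = 0" by (simp only: mult_1_left) simp
  then show "\<exists>y. supported S y \<and> form V X (\<lambda>i. x i - y i) (\<lambda>i. x i - y i) = 0"
    using z(1) by blast
qed

text \<open>If the Gram vectors of \<open>A\<close> do not span, some unit vector is orthogonal to all of them.\<close>

lemma not_generates_normal:
  assumes "psd V X" "finite V" "A \<subseteq> V" "\<not> generates V X A"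
  obtains f where "supported V f" "form V X f f = 1"
    "\<And>z. supported A z \<Longrightarrow> form V X z f = 0"
proof -
  obtain x where x: "supported V x"
    "\<And>y. supported A y \<Longrightarrow> form V X (\<lambda>i. x i - y i) (\<lambda>i. x i - y i) \<noteq> 0"
    using assms(4) unfolding generates_def by blast
  obtain y where y: "supported A y" "\<And>z. supported A z \<Longrightarrow> form V X z (\<lambda>i. x i - y i) = 0"
    using orthogonal_projection_exists[OF assms(1) finite_subset[OF assms(3,2)], of x] by blast
  define n where "n = (\<lambda>i. x i - y i)"
  define c where "c = form V X n n"
  have c: "c > 0"
    using x(2)[OF y(1)] psd_form_nonneg[OF assms(1), of n] unfolding c_def n_def by linarith
  show thesis
  proof (rule that[of "\<lambda>i. 1 / sqrt c * n i"])
    show "supported V (\<lambda>i. 1 / sqrt c * n i)"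
      using x(1) y(1) assms(3) by (auto simp: supported_def n_def)
    show "form V X (\<lambda>i. 1 / sqrt c * n i) (\<lambda>i. 1 / sqrt c * n i) = 1"
      unfolding form_linear(5,6) c_def[symmetric] using c by (simp add: field_simps)
    show "form V X z (\<lambda>i. 1 / sqrt c * n i) = 0" if "supported A z" for z
      unfolding form_linear(6) n_def y(2)[OF that] by simp
  qed
qed

text \<open>A vector of norm \<open>0\<close> is a linear relation between the columns.\<close>

lemma generates_imp_rank_le:
  assumes "finite V" "psd V X" "S \<subseteq> V" "generates V X S"
  shows "matrix_rank V X \<le> card S"
proof -
  define col where "col j = (\<lambda>i. if i \<in> V then X i j else 0)" for j
  have finS: "finite S" using assms(1,3) finite_subset by blast
  have comb: "(\<lambda>i. \<Sum>k\<in>T. y k * col k i) \<in> fun_space.span (col ` S)" if "T \<subseteq> S" for T y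
    using finite_subset[OF that finS] that
  proof (induction T rule: finite_induct)
    case empty
    then show ?case using fun_space.span_zero[of "col ` S"] by (simp add: zero_fun_def)
  next
    case (insert t T)
    have "(\<lambda>i. y t * col t i) + (\<lambda>i. \<Sum>k\<in>T. y k * col k i) \<in> fun_space.span (col ` S)"
    proof (rule fun_space.span_add)
      show "(\<lambda>i. y t * col t i) \<in> fun_space.span (col ` S)"
        using insert.prems by (intro fun_space.span_scale fun_space.span_base) auto
    qed (use insert in auto)
    then show ?case using insert.hyps by (simp add: plus_fun_def)
  qed
  have "col j \<in> fun_space.span (col ` S)" if j: "j \<in> V" for j
  proof -
    let ?e = "\<lambda>i k. of_bool (k = i) :: real"
    have "supported V (?e j)" using j by (auto simp: supported_def)
    then obtain y where y: "supported S y" "form V X (\<lambda>k. ?e j k - y k) (\<lambda>k. ?e j k - y k) = 0"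
      using assms(4) unfolding generates_def by blast
    have "col j i = (\<Sum>k\<in>S. y k * col k i)" for i
    proof (cases "i \<in> V")
      case True
      have "form V X (?e i) (\<lambda>k. ?e j k - y k) = 0"
        by (rule psd_isotropic_in_kernel(2)[OF assms(2) y(2)])
      then have "X i j = form V X (?e i) y"
        using form_unit[OF assms(1) True j, of X] by simp
      also have "\<dots> = (\<Sum>k\<in>S. X i k * y k)"
        unfolding form_unit_left[OF assms(1) True] using assms(1,3) y(1)
        by (intro sum.mono_neutral_right) (auto simp: supported_def)
      finally show ?thesis using True by (simp add: col_def mult.commute)
    qed (simp add: col_def)
    then have "col j = (\<lambda>i. \<Sum>k\<in>S. y k * col k i)" by blast
    then show ?thesis using comb[of S y] by simp
  qed
  then have "fun_space.dim (col ` V) \<le> card (col ` S)"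
    using finS by (intro fun_space.dim_le_card) auto
  also have "\<dots> \<le> card S" by (rule card_image_le[OF finS])
  finally show ?thesis by (simp add: matrix_rank_def col_def)
qed

text \<open>Each column of the block is nonzero in a coordinate where the other columns of the block vanish.\<close>

lemma orthogonal_block_rank:
  assumes "finite V" "B \<subseteq> V"
    and "\<And>b. b \<in> B \<Longrightarrow> X b b \<noteq> 0" "\<And>a b. a \<in> B \<Longrightarrow> b \<in> B \<Longrightarrow> a \<noteq> b \<Longrightarrow> X a b = 0"
  shows "card B \<le> matrix_rank V X"
proof -
  define col where "col j = (\<lambda>i. if i \<in> V then X i j else 0)" for j
  have val: "col b a = X a b" if "a \<in> B" for a b using that assms(2) by (auto simp: col_def)
  have inj: "inj_on col B"
  proof (rule inj_onI)
    fix a b assume ab: "a \<in> B" "b \<in> B" "col a = col b"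
    then have "X a a = X a b" using val[of a a] val[of a b] by simp
    then show "a = b" using assms(3)[OF ab(1)] assms(4)[OF ab(1,2)] by auto
  qed
  have "fun_space.independent (col ` B)"
    unfolding fun_space.dependent_def
  proof
    assume "\<exists>f\<in>col ` B. f \<in> fun_space.span (col ` B - {f})"
    then obtain b where b: "b \<in> B" "col b \<in> fun_space.span (col ` B - {col b})" by blast
    have "fun_space.subspace {f. f b = 0}"
      by (simp add: fun_space.subspace_def)
    moreover have "col ` B - {col b} \<subseteq> {f. f b = 0}"
    proof
      fix f assume "f \<in> col ` B - {col b}"
      then obtain c where "f = col c" "c \<in> B" "b \<noteq> c" by auto
      then show "f \<in> {f. f b = 0}" using val[OF b(1), of c] assms(4)[OF b(1), of c] by simp
    qed
    ultimately have "col b \<in> {f. f b = 0}" using b(2) fun_space.span_minimal by blast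
    then show False using val[OF b(1), of b] assms(3)[OF b(1)] by simp
  qed
  moreover obtain T where T: "T \<subseteq> col ` V" "col ` V \<subseteq> fun_space.span T" "card T = fun_space.dim (col ` V)"
    using fun_space.basis_exists[of "col ` V"] by metis
  ultimately have "card (col ` B) \<le> card T"
    using fun_space.independent_span_bound[of T "col ` B"] assms(1,2) finite_subset by blast
  then show ?thesis using T(3) card_image[OF inj] by (simp add: matrix_rank_def col_def)
qed

section \<open>Lowering the rank of a positive semidefinite matrix\<close>

text \<open>With Gram vectors \<open>u\<close>, and with \<open>f\<close> and \<open>g\<close> read as vectors in their span, this is the symmetric
  matrix with entries \<open>\<langle>u\<^sub>i, f\<rangle>\<langle>u\<^sub>j, g\<rangle> + \<langle>u\<^sub>i, g\<rangle>\<langle>u\<^sub>j, f\<rangle>\<close>. If \<open>f\<close> is orthogonal to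
  the nodes of \<open>A\<close> and \<open>g\<close> to those of \<open>B\<close>, it vanishes on \<open>A \<times> A\<close> and on \<open>B \<times> B\<close>.\<close>

definition cross_update ::
    "'a set \<Rightarrow> ('a \<Rightarrow> 'a \<Rightarrow> real) \<Rightarrow> ('a \<Rightarrow> real) \<Rightarrow> ('a \<Rightarrow> real) \<Rightarrow> 'a \<Rightarrow> 'a \<Rightarrow> real" where
  "cross_update V X f g i j = (if i \<in> V \<and> j \<in> V then
     (\<Sum>k\<in>V. X i k * f k) * (\<Sum>k\<in>V. X j k * g k) + (\<Sum>k\<in>V. X i k * g k) * (\<Sum>k\<in>V. X j k * f k)
   else 0)"

lemma form_cross_update:
  "form V (\<lambda>i j. X i j + t * cross_update V X f g i j) x y
    = form V X x y + t * (form V X x f * form V X y g + form V X x g * form V X y f)"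
proof -
  have f: "form V X x f = (\<Sum>i\<in>V. x i * (\<Sum>k\<in>V. X i k * f k))" for x f
    by (simp add: form_def sum_distrib_left mult.assoc)
  have prod: "t * ((\<Sum>i\<in>V. a i) * (\<Sum>j\<in>V. b j)) = (\<Sum>i\<in>V. \<Sum>j\<in>V. t * (a i * b j))" for a b
    by (subst sum_product) (simp only: sum_distrib_left)
  let ?p = "\<lambda>i. \<Sum>k\<in>V. X i k * f k" and ?q = "\<lambda>i. \<Sum>k\<in>V. X i k * g k"
  have "form V (\<lambda>i j. X i j + t * cross_update V X f g i j) x y
     = (\<Sum>i\<in>V. \<Sum>j\<in>V. x i * X i j * y j + (t * ((x i * ?p i) * (y j * ?q j))
          + t * ((x i * ?q i) * (y j * ?p j))))"
    unfolding form_def by (intro sum.cong refl) (simp add: cross_update_def algebra_simps)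
  also have "\<dots> = form V X x y + (t * (form V X x f * form V X y g) + t * (form V X x g * form V X y f))"
    unfolding f[of x f] f[of x g] f[of y f] f[of y g] prod sum.distrib by (simp only: form_def)
  finally show ?thesis by (simp add: algebra_simps)
qed

text \<open>For unit vectors with inner product \<open>c\<close>, the eigenvalues of \<open>f g\<^sup>T + g f\<^sup>T\<close> on the span of
  \<open>f\<close> and \<open>g\<close> are \<open>c + 1\<close> and \<open>c - 1\<close>. Hence \<open>1 / (1 - c)\<close> is the largest multiple that can be
  added to the identity, and it turns \<open>f - g\<close> into a kernel vector. The old kernel survives, so modulo
  the new kernel one of the generators is a combination of the others. The case \<open>c = 1\<close> would mean
  \<open>f = g\<close>, a unit vector orthogonal to all nodes.\<close>

lemma cross_update_lowers_rank:
  assumes psd: "psd V X" and fin: "finite V" and V: "V = A \<union> B" and gen: "generates V X S"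
    and f: "supported V f" "form V X f f = 1" "\<And>z. supported A z \<Longrightarrow> form V X z f = 0"
    and g: "supported V g" "form V X g g = 1" "\<And>z. supported B z \<Longrightarrow> form V X z g = 0"
  shows "form V X f g < 1"
    and "psd V (\<lambda>i j. X i j + 1 / (1 - form V X f g) * cross_update V X f g i j)" (is "psd V ?Y")
    and "\<exists>s\<in>S. generates V (\<lambda>i j. X i j + 1 / (1 - form V X f g) * cross_update V X f g i j) (S - {s})"
proof -
  define c where "c = form V X f g"
  define n where "n = (\<lambda>i. f i - g i)"
  have gf: "form V X g f = c" unfolding c_def by (rule psd_form_commute[OF psd])
  have nn: "form V X n n = 2 - 2 * c" unfolding n_def by (simp add: f(2) g(2) gf c_def)
  have nonzero: "form V X n n \<noteq> 0"
  proof
    assume z: "form V X n n = 0"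
    let ?fA = "\<lambda>i. if i \<in> A then f i else 0" and ?fB = "\<lambda>i. if i \<in> A then 0 else f i"
    have sA: "supported A ?fA" and sB: "supported B ?fB"
      using f(1) V by (auto simp: supported_def)
    have "form V X ?fB n = 0" by (rule psd_isotropic_in_kernel(2)[OF psd z])
    then have fB: "form V X ?fB f = 0" unfolding n_def using g(3)[OF sB] by simp
    have "f = (\<lambda>i. ?fA i + ?fB i)" by auto
    then have "form V X f f = form V X ?fA f + form V X ?fB f"
      using form_linear(1)[of V X ?fA ?fB f] by simp
    then show False using f(2) f(3)[OF sA] fB by simp
  qed
  have c1: "c < 1" using psd_form_nonneg[OF psd, of n] nonzero unfolding nn by linarith
  then show "form V X f g < 1" by (simp add: c_def)
  note Y = form_cross_update[of V X "1 / (1 - c)" f g]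
  have psdY: "psd V ?Y"
    unfolding psd_def
  proof (intro conjI ballI allI)
    fix i j assume "i \<in> V" "j \<in> V"
    then show "?Y i j = ?Y j i" using psd by (simp add: cross_update_def psd_def algebra_simps)
  next
    fix x :: "'a \<Rightarrow> real"
    define a where "a = form V X x f"
    define b where "b = form V X x g"
    have fx: "form V X f x = a" "form V X g x = b"
      unfolding a_def b_def by (rule psd_form_commute[OF psd])+
    have xn: "form V X x n = a - b" "form V X n x = a - b"
      unfolding n_def by (simp_all add: fx a_def b_def)
    \<comment> \<open>The Cauchy-Schwarz inequality for \<open>x\<close> and \<open>f - g\<close>, in the form of a square.\<close>
    define u where "u = (a - b) / (2 - 2 * c)"
    have "0 \<le> form V X (\<lambda>i. x i - u * n i) (\<lambda>i. x i - u * n i)"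
      by (rule psd_form_nonneg[OF psd])
    also have "\<dots> = form V X x x - 2 * u * (a - b) + u * (u * (2 - 2 * c))"
      unfolding form_linear xn nn by (simp add: algebra_simps)
    also have "\<dots> = form V X x x - (a - b)\<^sup>2 / (2 - 2 * c)"
      using c1 by (simp add: u_def power2_eq_square)
    finally have cs: "(a - b)\<^sup>2 / (2 - 2 * c) \<le> form V X x x" by simp
    have "form V ?Y x x = form V X x x + 1 / (1 - c) * (a * b + b * a)"
      using Y[of x x] unfolding a_def b_def c_def .
    also have "1 / (1 - c) * (a * b + b * a) = 2 * a * b / (1 - c)" by simp
    finally have "form V ?Y x x = form V X x x + 2 * a * b / (1 - c)" .
    moreover have "2 * a * b / (1 - c) = (a + b)\<^sup>2 / (2 - 2 * c) - (a - b)\<^sup>2 / (2 - 2 * c)"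
    proof -
      have "(a + b)\<^sup>2 - (a - b)\<^sup>2 = 2 * (2 * a * b)"
        by (simp add: power2_eq_square algebra_simps)
      then show ?thesis
        unfolding diff_divide_distrib[symmetric] using mult_divide_mult_cancel_left[of 2 "2 * a * b" "1 - c"]
        by (simp add: right_diff_distrib)
    qed
    moreover have "0 \<le> (a + b)\<^sup>2 / (2 - 2 * c)" using c1 by simp
    ultimately have "0 \<le> form V ?Y x x" using cs by linarith
    then show "0 \<le> (\<Sum>i\<in>V. \<Sum>j\<in>V. x i * ?Y i j * x j)" by (simp add: form_def)
  qed
  then show "psd V ?Y" .
  have kernel: "form V ?Y x x = 0" if "form V X x x = 0" for x
    unfolding form_cross_update using that psd_isotropic_in_kernel(1)[OF psd that] by simp
  have nf: "form V X n f = 1 - c" "form V X n g = c - 1"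
    unfolding n_def by (simp_all add: f(2) g(2) gf c_def)
  have Yn: "form V ?Y n n = 0"
    unfolding form_cross_update c_def[symmetric] nn nf using c1 by (simp add: field_simps)
  have "supported V n" using f(1) g(1) by (simp add: supported_def n_def)
  then obtain s where s: "supported S s" "form V X (\<lambda>i. n i - s i) (\<lambda>i. n i - s i) = 0"
    using gen unfolding generates_def by blast
  have "form V ?Y (\<lambda>i. n i + (-1) * (n i - s i)) (\<lambda>i. n i + (-1) * (n i - s i)) = 0"
    using psd_isotropic_combination[OF psdY Yn kernel[OF s(2)]] .
  then have Ys: "form V ?Y s s = 0" by (simp only: minus_one_mult_self mult_minus1) simp
  have "s \<noteq> (\<lambda>_. 0)" using s(2) nonzero by auto
  then obtain i where i: "s i \<noteq> 0" by auto
  then have iS: "i \<in> S" using s(1) by (auto simp: supported_def)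
  have "generates V ?Y (S - {i})"
    unfolding generates_def
  proof (intro allI impI)
    fix x :: "'a \<Rightarrow> real" assume "supported V x"
    then obtain y where y: "supported S y" "form V X (\<lambda>k. x k - y k) (\<lambda>k. x k - y k) = 0"
      using gen unfolding generates_def by blast
    let ?y = "\<lambda>k. y k - y i / s i * s k"
    have "supported (S - {i}) ?y" using y(1) s(1) i by (auto simp: supported_def)
    moreover have "form V ?Y (\<lambda>k. x k - ?y k) (\<lambda>k. x k - ?y k) = 0"
      using psd_isotropic_combination[OF psdY kernel[OF y(2)] Ys, of "y i / s i"]
      by (simp only: diff_diff_eq2 diff_add_eq)
    ultimately show "\<exists>y. supported (S - {i}) y \<and> form V ?Y (\<lambda>k. x k - y k) (\<lambda>k. x k - y k) = 0"
      by blast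
  qed
  then show "\<exists>s\<in>S. generates V ?Y (S - {s})" using iS by blast
qed

text \<open>The update is repeated until the nodes of \<open>A\<close> or those of \<open>B\<close> span everything; each round removes a
  generator. The entries inside \<open>A\<close> and inside \<open>B\<close> never change.\<close>

lemma rank_reduction:
  fixes F :: "('a \<Rightarrow> 'a \<Rightarrow> real) \<Rightarrow> real"
  assumes fin: "finite V" and V: "V = A \<union> B"
    and F: "\<And>X Z t. F (\<lambda>i j. X i j + t * Z i j) = F X + t * F Z"
    and "psd V X" "generates V X S" "finite S"
  shows "\<exists>Y. psd V Y \<and> (generates V Y A \<or> generates V Y B) \<and> F X \<le> F Y \<and>
    (\<forall>i j. i \<in> A \<and> j \<in> A \<or> i \<in> B \<and> j \<in> B \<or> i \<notin> V \<or> j \<notin> V \<longrightarrow> Y i j = X i j)"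
  using assms(4-)
proof (induction "card S" arbitrary: X S rule: less_induct)
  case less
  show ?case
  proof (cases "generates V X A \<or> generates V X B")
    case True
    then show ?thesis using less.prems by auto
  next
    case False
    obtain f where f: "supported V f" "form V X f f = 1"
      "\<And>z. supported A z \<Longrightarrow> form V X z f = 0"
      using not_generates_normal[OF less.prems(1) fin, of A] False V by blast
    obtain g where g: "supported V g" "form V X g g = 1"
      "\<And>z. supported B z \<Longrightarrow> form V X z g = 0"
      using not_generates_normal[OF less.prems(1) fin, of B] False V by blast
    \<comment> \<open>Replacing \<open>f\<close> by \<open>-f\<close> reverses the update, so one of the two choices does not decrease \<open>F\<close>.\<close>
    obtain h where h: "supported V h" "form V X h h = 1"
      "\<And>z. supported A z \<Longrightarrow> form V X z h = 0" "0 \<le> F (cross_update V X h g)"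
    proof (cases "0 \<le> F (cross_update V X f g)")
      case True
      then show ?thesis using that f by blast
    next
      case False
      let ?h = "\<lambda>i. - 1 * f i"
      have neg: "cross_update V X ?h g = (\<lambda>i j. 0 + (- 1) * cross_update V X f g i j)"
        by (intro ext) (simp add: cross_update_def sum_negf)
      have zero: "F (\<lambda>i j. 0) = 0" using F[of "\<lambda>i j. 0" 0 "\<lambda>i j. 0"] F[of "\<lambda>i j. 0" 1 "\<lambda>i j. 0"] by simp
      have "F (cross_update V X ?h g) = - F (cross_update V X f g)"
        unfolding neg using F[of "\<lambda>i j. 0" "-1" "cross_update V X f g"] zero by simp
      moreover have "supported V ?h" using f(1) by (simp add: supported_def)
      moreover have "form V X ?h ?h = 1" unfolding form_linear(5,6) using f(2) by simp
      moreover have "form V X z ?h = 0" if "supported A z" for z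
        unfolding form_linear(6) f(3)[OF that] by simp
      ultimately show ?thesis using that[of ?h] False by simp
    qed
    define c where "c = form V X h g"
    define Y where "Y = (\<lambda>i j. X i j + 1 / (1 - c) * cross_update V X h g i j)"
    note step = cross_update_lowers_rank[OF less.prems(1) fin V less.prems(2) h(1-3) g,
        folded c_def, folded Y_def]
    obtain s where s: "s \<in> S" "generates V Y (S - {s})" using step(3) by blast
    have "card (S - {s}) < card S" using s(1) less.prems(3) by (rule_tac psubset_card_mono) auto
    from less.hyps[OF this step(2) s(2)] less.prems(3)
    obtain Y' where Y': "psd V Y'" "generates V Y' A \<or> generates V Y' B" "F Y \<le> F Y'"
      "\<And>i j. i \<in> A \<and> j \<in> A \<or> i \<in> B \<and> j \<in> B \<or> i \<notin> V \<or> j \<notin> V \<Longrightarrow> Y' i j = Y i j"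
      by auto
    have "F X \<le> F Y" unfolding Y_def F using h(4) step(1) by simp
    have p0: "(\<Sum>k\<in>V. X i k * h k) = 0" if "i \<in> A" for i
      using h(3)[of "\<lambda>k. of_bool (k = i)"] form_unit_left[OF fin, of i X h] that V
      by (auto simp: supported_def)
    have q0: "(\<Sum>k\<in>V. X i k * g k) = 0" if "i \<in> B" for i
      using g(3)[of "\<lambda>k. of_bool (k = i)"] form_unit_left[OF fin, of i X g] that V
      by (auto simp: supported_def)
    have "Y i j = X i j" if "i \<in> A \<and> j \<in> A \<or> i \<in> B \<and> j \<in> B \<or> i \<notin> V \<or> j \<notin> V" for i j
      using that p0 q0 by (auto simp: Y_def cross_update_def)
    then show ?thesis
      using Y' \<open>F X \<le> F Y\<close> by (intro exI[of _ Y']) auto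
  qed
qed

section \<open>Interval layouts bound the extreme Gram dimension\<close>

text \<open>Node \<open>v\<close> occupies the levels from \<open>lo v\<close> to \<open>hi v\<close>. Equivalently, the graph is a minor of the
  strong product of a path and the complete graph on \<open>k\<close> nodes.\<close>

definition interval_layout :: "nat \<Rightarrow> 'a graph \<Rightarrow> ('a \<Rightarrow> nat) \<Rightarrow> ('a \<Rightarrow> nat) \<Rightarrow> bool" where
  "interval_layout k G lo hi \<longleftrightarrow>
    (\<forall>v\<in>nodes G. lo v \<le> hi v) \<and>
    (\<forall>t. card {v \<in> nodes G. lo v \<le> t \<and> t \<le> hi v} \<le> k) \<and>
    (\<forall>u v. {u, v} \<in> edges G \<longrightarrow> lo u \<le> hi v + 1)"

lemma edge_subset_nodes: "simple_graph G \<Longrightarrow> {u, v} \<in> edges G \<Longrightarrow> u \<in> nodes G \<and> v \<in> nodes G"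
  by (auto simp: simple_graph_def)

lemma finite_arcs:
  assumes "simple_graph G"
  shows "finite {(i, j). {i, j} \<in> edges G}"
proof (rule finite_subset)
  show "{(i, j). {i, j} \<in> edges G} \<subseteq> nodes G \<times> nodes G"
    using edge_subset_nodes[OF assms] by auto
  show "finite (nodes G \<times> nodes G)" using assms by (simp add: simple_graph_def)
qed

lemma sdp_objective_linear:
  "sdp_objective G w (\<lambda>i j. X i j + t * Z i j) = sdp_objective G w X + t * sdp_objective G w Z"
  unfolding sdp_objective_def
  by (simp add: sum.distrib sum_distrib_left algebra_simps case_prod_unfold add_divide_distrib)

lemma sdp_objective_cong:
  assumes "\<And>i j. {i, j} \<in> edges G \<Longrightarrow> X i j = Y i j"
  shows "sdp_objective G w X = sdp_objective G w Y"
  unfolding sdp_objective_def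
  by (intro arg_cong2[of _ _ _ _ "(/)"] sum.cong refl) (auto simp: assms)

text \<open>The matrix is improved level by level. Before level \<open>t\<close> the nodes of \<open>A t\<close>, which start below
  level \<open>t\<close>, are spanned by at most \<open>k\<close> of them; level \<open>t\<close> adds a bag \<open>B\<close> of at most \<open>k\<close> nodes. After
  the rank reduction on \<open>A t \<union> B\<close> the new part is spanned by \<open>A t\<close> or by \<open>B\<close>, hence again by at most
  \<open>k\<close> nodes. The nodes \<open>D\<close> that reach level \<open>t\<close> or a higher one meet the new part only in \<open>B\<close>, whose
  entries were kept, so they can be glued back; since every edge lies inside one of the two parts,
  gluing does not affect the objective.\<close>

lemma interval_layout_low_rank:
  assumes G: "simple_graph G" and L: "interval_layout k G lo hi" and X: "sdp_feasible G X"
  obtains Y where "sdp_feasible G Y" "sdp_objective G w X \<le> sdp_objective G w Y"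
    "matrix_rank (nodes G) Y \<le> k"
proof -
  let ?V = "nodes G" and ?F = "sdp_objective G w"
  define A where "A t = {v \<in> ?V. lo v < t}" for t
  have fin: "finite ?V" using G by (simp add: simple_graph_def)
  have lohi: "\<And>v. v \<in> ?V \<Longrightarrow> lo v \<le> hi v"
    and bag: "\<And>t. card {v \<in> ?V. lo v \<le> t \<and> t \<le> hi v} \<le> k"
    and adj: "\<And>u v. {u, v} \<in> edges G \<Longrightarrow> lo u \<le> hi v + 1"
    using L by (auto simp: interval_layout_def)
  have sweep: "\<exists>Y S. sdp_feasible G Y \<and> ?F X \<le> ?F Y \<and> S \<subseteq> A t \<and> card S \<le> k \<and> generates (A t) Y S" for t
  proof (induction t)
    case 0
    show ?case using X generates_self[of "A 0" X] by (intro exI[of _ X] exI[of _ "{}"]) (auto simp: A_def)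
  next
    case (Suc t)
    then obtain X0 S where X0: "sdp_feasible G X0" "?F X \<le> ?F X0"
      and S: "S \<subseteq> A t" "card S \<le> k" "generates (A t) X0 S" by blast
    define B where "B = {v \<in> ?V. lo v \<le> t \<and> t \<le> hi v}"
    define C where "C = A (Suc t)"
    define D where "D = {v \<in> ?V. t \<le> hi v}"
    have finC: "finite C" "finite D" using fin by (auto simp: C_def A_def D_def)
    have sub: "C \<subseteq> ?V" "D \<subseteq> ?V" by (auto simp: C_def A_def D_def)
    have CAB: "C = A t \<union> B" using lohi by (auto simp: A_def B_def C_def less_Suc_eq)
    have CD: "C \<inter> D = B" "C \<union> D = ?V" using lohi by (auto simp: A_def B_def C_def D_def) (force dest: lohi)
    have psd0: "psd ?V X0" "\<And>i. i \<in> ?V \<Longrightarrow> X0 i i = 1" using X0(1) by (auto simp: sdp_feasible_def)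
    obtain X1 where X1: "psd C X1" "generates C X1 (A t) \<or> generates C X1 B" "?F X0 \<le> ?F X1"
      "\<And>i j. i \<in> A t \<and> j \<in> A t \<or> i \<in> B \<and> j \<in> B \<or> i \<notin> C \<or> j \<notin> C \<Longrightarrow> X1 i j = X0 i j"
      using rank_reduction[where F = "?F", OF finC(1) CAB sdp_objective_linear psd_restrict[OF psd0(1) sub(1) fin]
        generates_self finC(1)] by auto
    obtain Y where Y: "psd ?V Y" "\<And>i j. i \<in> C \<Longrightarrow> j \<in> C \<Longrightarrow> Y i j = X1 i j"
      "\<And>i j. i \<in> D \<Longrightarrow> j \<in> D \<Longrightarrow> Y i j = X0 i j"
      using psd_glue[OF finC X1(1) psd_restrict[OF psd0(1) sub(2) fin]] X1(4) CD by metis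
    have feas: "sdp_feasible G Y"
      unfolding sdp_feasible_def
    proof (intro conjI ballI Y(1))
      fix i assume i: "i \<in> ?V"
      show "Y i i = 1"
      proof (cases "i \<in> C")
        case True
        then show ?thesis using X1(4)[of i i] psd0(2)[OF i] Y(2)[of i i] CAB by auto
      next
        case False
        then show ?thesis using Y(3)[of i i] psd0(2)[OF i] i CD(2) by auto
      qed
    qed
    have "?F Y = ?F X1"
    proof (rule sdp_objective_cong)
      fix i j assume e: "{i, j} \<in> edges G"
      then have ij: "i \<in> ?V" "j \<in> ?V" using edge_subset_nodes[OF G] by auto
      have "i \<in> C \<and> j \<in> C \<or> i \<in> D \<and> j \<in> D"
      proof -
        have "lo i \<le> hi j + 1" "lo j \<le> hi i + 1" using e adj[of i j] adj[of j i] by (auto simp: insert_commute)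
        then show ?thesis using ij lohi[OF ij(1)] lohi[OF ij(2)] by (auto simp: C_def D_def A_def)
      qed
      then show "Y i j = X1 i j"
      proof
        assume d: "i \<in> D \<and> j \<in> D"
        show ?thesis
        proof (cases "i \<in> C \<and> j \<in> C")
          case False
          then show ?thesis using Y(3)[of i j] X1(4)[of i j] d by auto
        qed (use Y(2) in auto)
      qed (use Y(2) in auto)
    qed
    then have obj: "?F X \<le> ?F Y" using X0(2) X1(3) by linarith
    have "\<exists>S'. S' \<subseteq> C \<and> card S' \<le> k \<and> generates C X1 S'"
      using X1(2)
    proof
      assume "generates C X1 (A t)"
      moreover have "generates (A t) X1 S"
        using S(3) generates_cong[of "A t" X1 X0 S] X1(4) by auto
      ultimately have "generates C X1 S"
        using generates_trans[OF X1(1) finC(1) S(1)] CAB by auto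
      then show ?thesis using S(1,2) CAB by blast
    next
      assume "generates C X1 B"
      then show ?thesis using bag[of t] CAB by (intro exI[of _ B]) (auto simp: B_def)
    qed
    then obtain S' where "S' \<subseteq> C" "card S' \<le> k" "generates C X1 S'" by blast
    moreover have "generates C Y S' = generates C X1 S'" by (intro generates_cong Y(2))
    ultimately show ?case using feas obj unfolding C_def by blast
  qed
  have "A (Suc (Max (insert 0 (lo ` ?V)))) = ?V"
    using fin by (auto simp: A_def less_Suc_eq_le)
  then obtain Y S where Y: "sdp_feasible G Y" "?F X \<le> ?F Y" "S \<subseteq> ?V" "card S \<le> k" "generates ?V Y S"
    using sweep[of "Suc (Max (insert 0 (lo ` ?V)))"] by auto
  have "matrix_rank ?V Y \<le> k"
    using generates_imp_rank_le[OF fin _ Y(3,5)] Y(1,4) by (simp add: sdp_feasible_def)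
  with Y that show thesis by blast
qed

lemma compact_Pi_UNIV:
  fixes S :: "'a \<Rightarrow> 'b::topological_space set"
  assumes "\<And>i. compact (S i)"
  shows "compact (PiE UNIV S)"
  using compactin_PiE[of "\<lambda>_. euclidean" UNIV S] assms
  by (simp add: euclidean_product_topology)

lemma continuous_on_entry [continuous_intros]:
  "continuous_on A (\<lambda>X :: 'a \<Rightarrow> 'b \<Rightarrow> 'c::topological_space. X i j)"
proof -
  have "continuous_on A (\<lambda>X :: 'a \<Rightarrow> 'b \<Rightarrow> 'c. X i)"
    by (rule continuous_on_subset[OF continuous_on_product_coordinates]) simp
  then show ?thesis by (rule continuous_on_product_then_coordinatewise)
qed

lemma sdp_feasible_entry_bound:
  assumes "finite (nodes G)" "sdp_feasible G X" "i \<in> nodes G" "j \<in> nodes G"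
  shows "\<bar>X i j\<bar> \<le> 1"
proof -
  let ?V = "nodes G" and ?e = "\<lambda>i k. of_bool (k = i) :: real"
  have X: "psd ?V X" "X i i = 1" "X j j = 1" "X j i = X i j"
    using assms by (auto simp: sdp_feasible_def psd_def)
  have "0 \<le> form ?V X (\<lambda>k. ?e i k + t * ?e j k) (\<lambda>k. ?e i k + t * ?e j k)" for t
    by (rule psd_form_nonneg[OF X(1)])
  then have "0 \<le> 1 + t * X i j + t * (X i j + t * 1)" for t
    unfolding form_linear using form_unit[OF assms(1)] assms(3,4) X(2-4) by (simp add: algebra_simps)
  from this[of 1] this[of "-1"] show ?thesis by simp
qed

text \<open>The entries outside \<open>nodes G\<close> are unconstrained, so they are set to \<open>0\<close> to obtain a compact set of
  functions; it is compact by Tychonoff's theorem.\<close>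

lemma sdp_optimal_exists:
  assumes G: "simple_graph G"
  shows "\<exists>X. sdp_optimal G w X"
proof -
  let ?V = "nodes G"
  have fin: "finite ?V" using G by (simp add: simple_graph_def)
  define K where "K = PiE UNIV (\<lambda>i. PiE UNIV (\<lambda>j. if i \<in> ?V \<and> j \<in> ?V then {-1..1::real} else {0}))"
  have cpt: "compact K" unfolding K_def by (intro compact_Pi_UNIV) auto
  have "closed {X. sdp_feasible G X}"
    unfolding sdp_feasible_def psd_def Ball_def
    by (intro closed_Collect_conj closed_Collect_all closed_Collect_imp closed_Collect_eq
        closed_Collect_le open_Collect_const continuous_intros)
  then have cpt': "compact (K \<inter> {X. sdp_feasible G X})" by (rule compact_Int_closed[OF cpt])
  have cut: "\<exists>Y \<in> K \<inter> {X. sdp_feasible G X}. sdp_objective G w Y = sdp_objective G w X"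
    if X: "sdp_feasible G X" for X
  proof -
    let ?Y = "\<lambda>i j. if i \<in> ?V \<and> j \<in> ?V then X i j else 0"
    have "?Y \<in> K"
      using sdp_feasible_entry_bound[OF fin X] by (auto simp: K_def abs_le_iff)
    moreover have "sdp_feasible G ?Y"
      using X by (auto simp: sdp_feasible_def psd_def)
    moreover have "sdp_objective G w ?Y = sdp_objective G w X"
      using edge_subset_nodes[OF G] by (intro sdp_objective_cong) auto
    ultimately show ?thesis by blast
  qed
  have "psd ?V (\<lambda>i j. of_bool (i = j))"
    unfolding psd_def
  proof (intro conjI ballI allI)
    fix x :: "'a \<Rightarrow> real"
    have "(\<Sum>i\<in>?V. \<Sum>j\<in>?V. x i * of_bool (i = j) * x j) = (\<Sum>i\<in>?V. \<Sum>j\<in>?V. if i = j then x i * x i else 0)"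
      by (intro sum.cong) auto
    also have "\<dots> = (\<Sum>i\<in>?V. x i * x i)" using fin by simp
    finally show "0 \<le> (\<Sum>i\<in>?V. \<Sum>j\<in>?V. x i * of_bool (i = j) * x j)" by (simp add: sum_nonneg)
  qed auto
  then have "sdp_feasible G (\<lambda>i j. of_bool (i = j))" by (simp add: sdp_feasible_def)
  from cut[OF this] have ne: "K \<inter> {X. sdp_feasible G X} \<noteq> {}" by blast
  have "continuous_on (K \<inter> {X. sdp_feasible G X}) (sdp_objective G w)"
    unfolding sdp_objective_def case_prod_unfold by (intro continuous_intros) simp
  from continuous_attains_sup[OF cpt' ne this]
  obtain X where X: "sdp_feasible G X" "\<And>Y. Y \<in> K \<inter> {X. sdp_feasible G X} \<Longrightarrow> sdp_objective G w Y \<le> sdp_objective G w X"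
    by auto
  have "sdp_optimal G w X"
    unfolding sdp_optimal_def using X cut by metis
  then show ?thesis by blast
qed

lemma interval_layout_optimal:
  assumes "simple_graph G" "interval_layout k G lo hi"
  shows "\<exists>X. sdp_optimal G w X \<and> matrix_rank (nodes G) X \<le> k"
proof -
  obtain X where X: "sdp_optimal G w X" using sdp_optimal_exists[OF assms(1)] by blast
  then have "sdp_feasible G X" by (simp add: sdp_optimal_def)
  from interval_layout_low_rank[OF assms this, of w] obtain Y where
    "sdp_feasible G Y" "sdp_objective G w X \<le> sdp_objective G w Y" "matrix_rank (nodes G) Y \<le> k" .
  moreover from this have "sdp_optimal G w Y"
    using X unfolding sdp_optimal_def by (meson order_trans)
  ultimately show ?thesis by blast
qed

lemma interval_layout_egd_le:
  assumes "simple_graph G" "interval_layout k G lo hi" "1 \<le> k"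
  shows "egd G \<le> k"
  unfolding egd_def using assms interval_layout_optimal[OF assms(1,2)] by (intro Least_le) blast

section \<open>Interval layouts of minors\<close>

lemma simple_graph_minor_step:
  assumes "minor_step G H" "simple_graph G"
  shows "simple_graph H"
  using assms
proof (induction rule: minor_step.induct)
  case (edge_contraction u v G)
  have e: "u \<in> nodes G" "u \<noteq> v" using edge_contraction by (auto simp: simple_graph_def)
  have "x \<in> nodes G \<and> x \<noteq> v" if "{v, x} \<in> edges G" for x
    using that edge_contraction.prems by (auto simp: simple_graph_def)
  with e edge_contraction.prems show ?case by (auto simp: simple_graph_def contract_edge_def)
qed (auto simp: simple_graph_def delete_edge_def delete_node_def)

text \<open>Covers subgraphs as well as isomorphic copies.\<close>

lemma interval_layout_pullback:
  assumes "interval_layout k H lo hi" "finite (nodes H)"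
    and "inj_on f (nodes G)" "f ` nodes G \<subseteq> nodes H" "\<And>u v. {u, v} \<in> edges G \<Longrightarrow> {f u, f v} \<in> edges H"
  shows "interval_layout k G (lo \<circ> f) (hi \<circ> f)"
  unfolding interval_layout_def
proof (intro conjI ballI allI impI)
  fix t
  have "card {v \<in> nodes G. (lo \<circ> f) v \<le> t \<and> t \<le> (hi \<circ> f) v} \<le> card {v \<in> nodes H. lo v \<le> t \<and> t \<le> hi v}"
    using assms by (intro card_inj_on_le[of f]) (auto intro: inj_on_subset)
  also have "\<dots> \<le> k" using assms(1) by (simp add: interval_layout_def)
  finally show "card {v \<in> nodes G. (lo \<circ> f) v \<le> t \<and> t \<le> (hi \<circ> f) v} \<le> k" .
qed (use assms in \<open>auto simp: interval_layout_def\<close>)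

text \<open>Touching intervals have an interval as their union, and the merged node is counted at a level only
  if one of its two constituents was.\<close>

lemma interval_layout_contract:
  assumes "interval_layout k G lo hi" "simple_graph G" "{u, v} \<in> edges G"
  shows "interval_layout k (contract_edge u v G) (lo(u := min (lo u) (lo v))) (hi(u := max (hi u) (hi v)))"
    (is "interval_layout k ?H ?lo ?hi")
proof -
  have G: "finite (nodes G)" "u \<noteq> v" "u \<in> nodes G" "v \<in> nodes G"
    using assms(2,3) by (auto simp: simple_graph_def)
  have le: "\<And>x. x \<in> nodes G \<Longrightarrow> lo x \<le> hi x"
    and bag: "\<And>t. card {x \<in> nodes G. lo x \<le> t \<and> t \<le> hi x} \<le> k"
    and adj: "\<And>x y. {x, y} \<in> edges G \<Longrightarrow> lo x \<le> hi y + 1"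
    using assms(1) by (auto simp: interval_layout_def)
  have adj': "lo y \<le> hi x + 1" if "{x, y} \<in> edges G" for x y
    using adj[of y x] that by (simp add: insert_commute)
  note uv = adj[OF assms(3)] adj'[OF assms(3)]
  show ?thesis
    unfolding interval_layout_def
  proof (intro conjI ballI allI impI)
    fix x assume "x \<in> nodes ?H"
    then show "?lo x \<le> ?hi x" using le G by (auto simp: contract_edge_def min_le_iff_disj le_max_iff_disj)
  next
    fix t
    let ?B = "{x \<in> nodes G. lo x \<le> t \<and> t \<le> hi x}"
    \<comment> \<open>When the merged node is in the bag, one of \<open>u\<close> and \<open>v\<close> already was.\<close>
    let ?f = "\<lambda>x. if x = u \<and> u \<notin> ?B then v else x"
    have "?f x \<in> ?B" if "x \<in> nodes ?H" "?lo x \<le> t" "t \<le> ?hi x" for x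
      using that uv G le[OF G(3)] le[OF G(4)] by (auto simp: contract_edge_def split: if_splits)
    then have "?f ` {x \<in> nodes ?H. ?lo x \<le> t \<and> t \<le> ?hi x} \<subseteq> ?B" by blast
    moreover have "inj_on ?f {x \<in> nodes ?H. ?lo x \<le> t \<and> t \<le> ?hi x}"
      by (auto simp: inj_on_def contract_edge_def)
    ultimately have "card {x \<in> nodes ?H. ?lo x \<le> t \<and> t \<le> ?hi x} \<le> card ?B"
      using G(1) by (intro card_inj_on_le[of ?f]) simp_all
    then show "card {x \<in> nodes ?H. ?lo x \<le> t \<and> t \<le> ?hi x} \<le> k"
      using bag[of t] by linarith
  next
    fix x y assume "{x, y} \<in> edges ?H"
    then have "{x, y} \<in> edges G \<and> x \<noteq> v \<and> y \<noteq> v \<or> x = u \<and> {v, y} \<in> edges G \<or> y = u \<and> {x, v} \<in> edges G"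
      by (auto simp: contract_edge_def doubleton_eq_iff insert_commute)
    then show "?lo x \<le> ?hi y + 1"
      using adj[of x y] adj[of v y] adj[of x v] by (auto simp: min_le_iff_disj le_max_iff_disj)
  qed
qed

lemma interval_layout_minor_step:
  assumes "minor_step G H" "simple_graph G" "\<exists>lo hi. interval_layout k G lo hi"
  shows "\<exists>lo hi. interval_layout k H lo hi"
  using assms
proof (induction rule: minor_step.induct)
  case (edge_contraction u v G)
  then obtain lo hi where "interval_layout k G lo hi" by blast
  from interval_layout_contract[OF this edge_contraction(2,1)] show ?case by blast
next
  case (edge_deletion e G)
  then obtain lo hi where "interval_layout k G lo hi" by blast
  then have "interval_layout k (delete_edge e G) (lo \<circ> id) (hi \<circ> id)"
    using edge_deletion by (intro interval_layout_pullback[of k G]) (auto simp: simple_graph_def delete_edge_def)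
  then show ?case by blast
next
  case (node_deletion v G)
  then obtain lo hi where "interval_layout k G lo hi" by blast
  then have "interval_layout k (delete_node v G) (lo \<circ> id) (hi \<circ> id)"
    using node_deletion by (intro interval_layout_pullback[of k G]) (auto simp: simple_graph_def delete_node_def)
  then show ?case by blast
qed

lemma proper_minors_layout:
  assumes "simple_graph G" "\<And>H. minor_step G H \<Longrightarrow> \<exists>lo hi. interval_layout k H lo hi" "proper_minor H G"
  shows "simple_graph H \<and> (\<exists>lo hi. interval_layout k H lo hi)"
  using assms(3) unfolding proper_minor_def
proof (induction rule: tranclp_induct)
  case (base H)
  then show ?case using assms(1,2) simple_graph_minor_step by blast
next
  case (step H H')
  then show ?case using simple_graph_minor_step interval_layout_minor_step by blast
qed

section \<open>The triangular grid and its rotation\<close>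

lemma nodes_tri_graph: "nodes (tri_graph r) = {(i, l). 1 \<le> i \<and> 1 \<le> l \<and> i + l \<le> r + 1}"
  by (auto simp: tri_graph_def)

inductive tri_edge :: "nat \<Rightarrow> nat \<times> nat \<Rightarrow> nat \<times> nat \<Rightarrow> bool" for r where
  row: "1 \<le> i \<Longrightarrow> 1 \<le> l \<Longrightarrow> i + l \<le> r \<Longrightarrow> tri_edge r (i, l) (i + 1, l)"
| column: "1 \<le> i \<Longrightarrow> 1 \<le> l \<Longrightarrow> i + l \<le> r \<Longrightarrow> tri_edge r (i, l) (i, l + 1)"
| diagonal: "1 \<le> i \<Longrightarrow> 1 \<le> l \<Longrightarrow> i + l \<le> r \<Longrightarrow> tri_edge r (i + 1, l) (i, l + 1)"

lemma edges_tri_graph: "edges (tri_graph r) = {{u, v} | u v. tri_edge r u v}"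
proof (intro equalityI subsetI)
  fix e assume "e \<in> edges (tri_graph r)"
  then obtain i l where "1 \<le> i" "1 \<le> l" "i + l \<le> r"
    "e = {(i, l), (i + 1, l)} \<or> e = {(i, l), (i, l + 1)} \<or> e = {(i + 1, l), (i, l + 1)}"
    by (fastforce simp: tri_graph_def)
  then show "e \<in> {{u, v} | u v. tri_edge r u v}"
    using tri_edge.intros[of i l r] by blast
next
  fix e assume "e \<in> {{u, v} | u v. tri_edge r u v}"
  then obtain u v where e: "e = {u, v}" "tri_edge r u v" by blast
  from e(2) obtain i l where il: "1 \<le> i" "1 \<le> l" "i + l \<le> r"
    and "e \<in> {{(i, l), (i + 1, l)}, {(i, l), (i, l + 1)}, {(i + 1, l), (i, l + 1)}}"
    unfolding e(1) by cases blast+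
  moreover have "l \<in> {1..r - 1}" "i \<in> {1..r - l}" using il by auto
  ultimately show "e \<in> edges (tri_graph r)"
    unfolding tri_graph_def graph.select_convs by blast
qed

lemma tri_edge_nodes:
  assumes "tri_edge r u v"
  shows "u \<in> nodes (tri_graph r)" "v \<in> nodes (tri_graph r)" "u \<noteq> v"
  using assms by (auto simp: nodes_tri_graph elim!: tri_edge.cases)

lemma doubleton_in_edges_tri_graph:
  "{u, v} \<in> edges (tri_graph r) \<longleftrightarrow> tri_edge r u v \<or> tri_edge r v u"
  unfolding edges_tri_graph mem_Collect_eq doubleton_eq_iff by blast

lemma simple_tri_graph: "simple_graph (tri_graph r)"
proof -
  have "nodes (tri_graph r) \<subseteq> {..r + 1} \<times> {..r + 1}" by (auto simp: nodes_tri_graph)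
  then have "finite (nodes (tri_graph r))" by (rule finite_subset) simp
  moreover have "e \<subseteq> nodes (tri_graph r) \<and> card e = 2" if e: "e \<in> edges (tri_graph r)" for e
  proof -
    obtain u v where "e = {u, v}" "tri_edge r u v" using e unfolding edges_tri_graph by blast
    then show ?thesis using tri_edge_nodes[of r u v] by simp
  qed
  ultimately show ?thesis by (simp add: simple_graph_def)
qed

text \<open>Row \<open>l\<close> has \<open>r + 1 - l\<close> nodes, and edges join nodes of equal or consecutive rows.\<close>

lemma tri_graph_row_layout: "interval_layout r (tri_graph r) snd snd"
  unfolding interval_layout_def
proof (intro conjI ballI allI impI)
  fix t
  have "card {v \<in> nodes (tri_graph r). snd v \<le> t \<and> t \<le> snd v} \<le> card {1..r}"
    by (rule card_inj_on_le[of fst]) (auto simp: inj_on_def nodes_tri_graph)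
  then show "card {v \<in> nodes (tri_graph r). snd v \<le> t \<and> t \<le> snd v} \<le> r" by simp
next
  fix u v assume "{u, v} \<in> edges (tri_graph r)"
  then show "snd u \<le> snd v + 1"
    unfolding doubleton_in_edges_tri_graph by (auto elim!: tri_edge.cases)
qed simp

text \<open>Rotation of the triangle by 120 degrees: it permutes the barycentric coordinates
  \<open>(i - 1, l - 1, r + 1 - i - l)\<close> cyclically, and hence the three directions of edges.\<close>

definition tri_rotate :: "nat \<Rightarrow> nat \<times> nat \<Rightarrow> nat \<times> nat" where
  "tri_rotate r = (\<lambda>(i, l). (l, r + 2 - i - l))"

lemma inj_on_tri_rotate: "inj_on (tri_rotate r) (nodes (tri_graph r))"
  by (auto simp: inj_on_def tri_rotate_def nodes_tri_graph)

lemma tri_rotate_nodes: "tri_rotate r ` nodes (tri_graph r) \<subseteq> nodes (tri_graph r)"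
  by (auto simp: tri_rotate_def nodes_tri_graph)

lemma tri_rotate_triangle:
  assumes "1 \<le> i" "1 \<le> l" "i + l \<le> r"
  obtains i' l' where "1 \<le> i'" "1 \<le> l'" "i' + l' \<le> r"
    "tri_rotate r (i, l) = (i', l' + 1)" "tri_rotate r (i + 1, l) = (i', l')" "tri_rotate r (i, l + 1) = (i' + 1, l')"
  using assms by (intro that[of l "r + 1 - i - l"]) (auto simp: tri_rotate_def)

lemma tri_rotate_edge:
  assumes "{u, v} \<in> edges (tri_graph r)"
  shows "{tri_rotate r u, tri_rotate r v} \<in> edges (tri_graph r)"
proof -
  have "tri_edge r (tri_rotate r v) (tri_rotate r u) \<or> tri_edge r (tri_rotate r u) (tri_rotate r v)" if "tri_edge r u v" for u v
    using that
  proof cases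
    case (row i l)
    then show ?thesis using tri_rotate_triangle[of i l r] tri_edge.intros[of _ _ r] by metis
  next
    case (column i l)
    then show ?thesis using tri_rotate_triangle[of i l r] tri_edge.intros[of _ _ r] by metis
  next
    case (diagonal i l)
    then show ?thesis using tri_rotate_triangle[of i l r] tri_edge.intros[of _ _ r] by metis
  qed
  then show ?thesis using assms unfolding doubleton_in_edges_tri_graph by blast
qed

lemma layout_delete_rotate:
  assumes "interval_layout k (delete_edge {tri_rotate r u, tri_rotate r v} (tri_graph r)) lo hi"
    and e: "{u, v} \<in> edges (tri_graph r)"
  shows "\<exists>lo hi. interval_layout k (delete_edge {u, v} (tri_graph r)) lo hi"
proof -
  let ?G = "tri_graph r" and ?f = "tri_rotate r"
  have "{?f x, ?f y} \<in> edges (delete_edge {?f u, ?f v} ?G)" if "{x, y} \<in> edges (delete_edge {u, v} ?G)" for x y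
  proof -
    have xy: "{x, y} \<in> edges ?G" "{x, y} \<noteq> {u, v}" using that by (auto simp: delete_edge_def)
    have "{x, y} \<subseteq> nodes ?G" "{u, v} \<subseteq> nodes ?G"
      using xy(1) e simple_tri_graph[of r] by (auto simp: simple_graph_def)
    then have "?f ` {x, y} \<noteq> ?f ` {u, v}"
      using inj_on_image_eq_iff[OF inj_on_tri_rotate] xy(2) by metis
    then show ?thesis using tri_rotate_edge[OF xy(1)] by (simp add: delete_edge_def)
  qed
  then have "interval_layout k (delete_edge {u, v} ?G) (lo \<circ> ?f) (hi \<circ> ?f)"
    using simple_tri_graph[of r] inj_on_tri_rotate tri_rotate_nodes
    by (intro interval_layout_pullback[OF assms(1)]) (auto simp: delete_edge_def simple_graph_def)
  then show ?thesis by blast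
qed

lemma layout_contract_rotate:
  assumes "interval_layout k (contract_edge (tri_rotate r u) (tri_rotate r v) (tri_graph r)) lo hi"
    and e: "{u, v} \<in> edges (tri_graph r)"
  shows "\<exists>lo hi. interval_layout k (contract_edge u v (tri_graph r)) lo hi"
proof -
  let ?G = "tri_graph r" and ?f = "tri_rotate r"
  let ?H = "contract_edge (?f u) (?f v) ?G"
  have sub: "x \<in> nodes ?G \<and> y \<in> nodes ?G" if "{x, y} \<in> edges ?G" for x y
    by (rule edge_subset_nodes[OF simple_tri_graph that])
  have eq: "?f x = ?f y \<longleftrightarrow> x = y" if "x \<in> nodes ?G" "y \<in> nodes ?G" for x y
    using inj_on_tri_rotate that by (auto dest: inj_onD)
  have merged: "{?f u, ?f x} \<in> edges ?H" if "{v, x} \<in> edges ?G" "x \<noteq> u" for x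
  proof -
    have "?f x \<noteq> ?f u" using eq[of x u] that(2) sub[OF that(1)] sub[OF e] by blast
    then show ?thesis
      using tri_rotate_edge[OF that(1)] unfolding contract_edge_def graph.select_convs by blast
  qed
  have "{?f x, ?f y} \<in> edges ?H" if "{x, y} \<in> edges (contract_edge u v ?G)" for x y
  proof -
    have "{x, y} \<in> edges ?G \<and> x \<noteq> v \<and> y \<noteq> v \<or> x = u \<and> {v, y} \<in> edges ?G \<and> y \<noteq> u
        \<or> y = u \<and> {v, x} \<in> edges ?G \<and> x \<noteq> u"
      using that unfolding contract_edge_def graph.select_convs Un_iff mem_Collect_eq doubleton_eq_iff by blast
    then show ?thesis
    proof (elim disjE conjE)
      assume xy: "{x, y} \<in> edges ?G" "x \<noteq> v" "y \<noteq> v"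
      then have "?f v \<notin> {?f x, ?f y}" using sub[OF xy(1)] sub[OF e] eq[of v x] eq[of v y] by blast
      then show ?thesis
        using tri_rotate_edge[OF xy(1)] unfolding contract_edge_def graph.select_convs by blast
    next
      assume "x = u" "{v, y} \<in> edges ?G" "y \<noteq> u"
      then show ?thesis using merged[of y] by simp
    next
      assume "y = u" "{v, x} \<in> edges ?G" "x \<noteq> u"
      then show ?thesis using merged[of x] by (simp add: insert_commute)
    qed
  qed
  moreover have "?f ` nodes (contract_edge u v ?G) \<subseteq> nodes ?H"
    unfolding contract_edge_def graph.select_convs
    using tri_rotate_nodes[of r] sub[OF e] eq by blast
  ultimately have "interval_layout k (contract_edge u v ?G) (lo \<circ> ?f) (hi \<circ> ?f)"
    using simple_tri_graph[of r] inj_on_subset[OF inj_on_tri_rotate]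
    by (intro interval_layout_pullback[OF assms(1)]) (auto simp: contract_edge_def simple_graph_def)
  then show ?thesis by blast
qed

section \<open>Bent rows\<close>

text \<open>The rows can be bent downwards around the node \<open>(c, 1)\<close>. In the level \<open>m + (J - d)\<close>, the number \<open>d\<close>
  is the distance of the fold index from \<open>c\<close>, and the truncated difference leaves rows unbent far from
  \<open>c\<close>. A bent row follows a row from the left, descends along a diagonal towards \<open>(c, 1)\<close>, and climbs
  along a column to rejoin the row. The fold index numbers its nodes from left to right.

  The indices range over \<open>1, \<dots>, r\<close> and are distinct on each level, but index \<open>c\<close> belongs to
  the node \<open>(c, 1)\<close> alone, which lies on level \<open>J + 1\<close>. So all levels except \<open>J + 1\<close> have at most
  \<open>r - 1\<close> nodes, and one modification at an edge near level \<open>J + 1\<close> repairs the exception.\<close>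

definition fold_index :: "nat \<Rightarrow> nat \<times> nat \<Rightarrow> nat" where
  "fold_index c = (\<lambda>(i, m). if 2 * i + m \<le> 2 * c + 1 then i else i + m - 1)"

definition folded_level :: "nat \<Rightarrow> nat \<Rightarrow> nat \<times> nat \<Rightarrow> nat" where
  "folded_level J c = (\<lambda>(i, m). m + (J - (if 2 * i + m \<le> 2 * c + 1 then c - i else i + m - 1 - c)))"

lemma folded_level_edge:
  assumes "tri_edge r u v"
  shows "folded_level J c u \<le> folded_level J c v + 1" "folded_level J c v \<le> folded_level J c u + 1"
  using assms by (auto simp: folded_level_def elim!: tri_edge.cases)

lemma fold_index_le_iff: "1 \<le> m \<Longrightarrow> fold_index c (i, m) \<le> c \<longleftrightarrow> 2 * i + m \<le> 2 * c + 1"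
  by (simp add: fold_index_def) arith

lemma folded_level_eq:
  assumes "1 \<le> m"
  shows "folded_level J c (i, m) = m + (J - (if fold_index c (i, m) \<le> c
    then c - fold_index c (i, m) else fold_index c (i, m) - c))"
  unfolding fold_index_le_iff[OF assms] by (simp add: folded_level_def fold_index_def)

text \<open>On a fixed level the fold index determines the row, because the bend depends on the index alone;
  index and row determine the node.\<close>

lemma inj_on_fold_index: "inj_on (fold_index c) {v \<in> nodes (tri_graph r). folded_level J c v = t}"
proof -
  have "i = i' \<and> m = m'" if m: "1 \<le> m" "1 \<le> m'" and eq: "fold_index c (i, m) = fold_index c (i', m')"
    and level: "folded_level J c (i, m) = folded_level J c (i', m')" for i m i' m'
  proof -
    have "m = m'" using level unfolding folded_level_eq[OF m(1)] folded_level_eq[OF m(2)] eq by simp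
    moreover have "2 * i + m \<le> 2 * c + 1 \<longleftrightarrow> 2 * i' + m' \<le> 2 * c + 1"
      using fold_index_le_iff[OF m(1)] fold_index_le_iff[OF m(2)] eq by metis
    ultimately show ?thesis using eq m by (auto simp: fold_index_def split: if_splits)
  qed
  note inj = this
  show ?thesis
  proof (rule inj_onI)
    fix v w
    assume vw: "v \<in> {v \<in> nodes (tri_graph r). folded_level J c v = t}"
      "w \<in> {v \<in> nodes (tri_graph r). folded_level J c v = t}" "fold_index c v = fold_index c w"
    obtain i m i' m' where eq: "v = (i, m)" "w = (i', m')" by (cases v, cases w)
    show "v = w" using inj[of m m' i i'] vw unfolding eq by (simp add: nodes_tri_graph)
  qed
qed

lemma fold_index_range: "v \<in> nodes (tri_graph r) \<Longrightarrow> fold_index c v \<in> {1..r}"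
  by (auto simp: fold_index_def nodes_tri_graph)

lemma fold_index_eq_centre:
  assumes "v \<in> nodes (tri_graph r)" "fold_index c v = c"
  shows "folded_level J c v = J + 1"
  using assms by (auto simp: fold_index_def folded_level_def nodes_tri_graph split: if_splits)

lemma fold_index_eq_next:
  assumes "v \<in> nodes (tri_graph r)" "fold_index c v = c + 1" "1 \<le> J"
  shows "folded_level J c v \<noteq> J + 2"
  using assms by (auto simp: fold_index_def folded_level_def nodes_tri_graph split: if_splits)

lemma card_level_less:
  assumes "A \<subseteq> {v \<in> nodes (tri_graph r). folded_level J c v = t}" "W \<subseteq> {1..r}" "\<forall>x\<in>A. fold_index c x \<notin> W"
  shows "card A \<le> r - card W"
proof -
  have "card A \<le> card ({1..r} - W)"
    using inj_on_subset[OF inj_on_fold_index assms(1)] fold_index_range assms(1,3)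
    by (intro card_inj_on_le[of "fold_index c"]) blast+
  also have "\<dots> = r - card W" using assms(2) by (simp add: card_Diff_subset finite_subset)
  finally show ?thesis .
qed

lemma layered_contract:
  assumes "simple_graph G" "{u, v} \<in> edges G" "h u = h v"
    and lip: "\<And>x y. {x, y} \<in> edges G \<Longrightarrow> h x \<le> h y + 1"
    and "\<And>t. card {x \<in> nodes G. x \<noteq> v \<and> h x = t} \<le> k"
  shows "interval_layout k (contract_edge u v G) h h"
  unfolding interval_layout_def
proof (intro conjI ballI allI impI)
  fix t
  have "{x \<in> nodes (contract_edge u v G). h x \<le> t \<and> t \<le> h x} = {x \<in> nodes G. x \<noteq> v \<and> h x = t}"
    by (auto simp: contract_edge_def)
  then show "card {x \<in> nodes (contract_edge u v G). h x \<le> t \<and> t \<le> h x} \<le> k" using assms(5) by simp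
next
  fix x y assume "{x, y} \<in> edges (contract_edge u v G)"
  then consider "{x, y} \<in> edges G" | "x = u" "{v, y} \<in> edges G" | "y = u" "{x, v} \<in> edges G"
    unfolding contract_edge_def graph.select_convs Un_iff mem_Collect_eq doubleton_eq_iff
    by (auto simp: insert_commute)
  then show "h x \<le> h y + 1"
  proof cases
    case 2
    then show ?thesis using lip[of v y] assms(3) by simp
  next
    case 3
    then show ?thesis using lip[of x v] assms(3) by simp
  qed (rule lip)
qed simp

lemma folded_level_adjacent:
  "{u, v} \<in> edges (tri_graph r) \<Longrightarrow> folded_level J c u \<le> folded_level J c v + 1"
  unfolding doubleton_in_edges_tri_graph using folded_level_edge by blast

text \<open>Bending around \<open>(i, 1)\<close> with \<open>J = l - 1\<close> puts both ends of the edge on the exceptional level, where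
  contracting the edge saves a node.\<close>

lemma layout_contract_row:
  assumes il: "1 \<le> i" "1 \<le> l" "i + l \<le> r" and uv: "{u, v} = {(i, l), (i + 1, l)}"
  shows "\<exists>lo hi. interval_layout (r - 1) (contract_edge u v (tri_graph r)) lo hi"
proof -
  define J where "J = l - 1"
  let ?G = "tri_graph r" and ?h = "folded_level J i"
  have e: "{u, v} \<in> edges ?G"
    unfolding uv doubleton_in_edges_tri_graph using tri_edge.row[OF il] by simp
  have lev: "?h (i, l) = J + 1" "?h (i + 1, l) = J + 1"
    using il by (auto simp: folded_level_def J_def)
  then have h: "?h u = J + 1" "?h v = J + 1" using uv by (auto simp: doubleton_eq_iff)
  have v: "v \<in> nodes ?G" using edge_subset_nodes[OF simple_tri_graph e] by simp
  have "card {x \<in> nodes ?G. x \<noteq> v \<and> ?h x = t} \<le> r - 1" for t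
  proof (cases "t = J + 1")
    case True
    have "fold_index i x \<noteq> fold_index i v" if "x \<in> nodes ?G" "x \<noteq> v" "?h x = t" for x
      using inj_onD[OF inj_on_fold_index[of i r J t], of x v] that v h(2) True by auto
    then have "card {x \<in> nodes ?G. x \<noteq> v \<and> ?h x = t} \<le> r - card {fold_index i v}"
      using fold_index_range[OF v, of i] by (intro card_level_less[where J = J and t = t]) blast+
    then show ?thesis by simp
  next
    case False
    have "fold_index i x \<noteq> i" if "x \<in> nodes ?G" "?h x = t" for x
      using fold_index_eq_centre[OF that(1), of i J] that(2) False by auto
    moreover have "{i} \<subseteq> {1..r}" using il by auto
    ultimately have "card {x \<in> nodes ?G. x \<noteq> v \<and> ?h x = t} \<le> r - card {i}"
      by (intro card_level_less[where J = J and t = t]) blast+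
    then show ?thesis by simp
  qed
  then have "interval_layout (r - 1) (contract_edge u v ?G) ?h ?h"
    using h folded_level_adjacent by (intro layered_contract[OF simple_tri_graph e]) auto
  then show ?thesis by blast
qed

text \<open>Without the edge, its upper end \<open>z = (c, l + 1)\<close> can be moved from the exceptional level \<open>l + 1\<close> to
  level \<open>l + 2\<close>: the other neighbours of \<open>z\<close> lie on levels \<open>l + 1\<close> and \<open>l + 2\<close>. There is room for
  \<open>z\<close> on level \<open>l + 2\<close>, where the indices \<open>c\<close> and \<open>c + 1\<close> are both missing.\<close>

lemma layout_delete_diagonal:
  assumes cl: "1 \<le> c" "1 \<le> l" "c + l \<le> r"
  shows "\<exists>lo hi. interval_layout (r - 1) (delete_edge {(c + 1, l), (c, l + 1)} (tri_graph r)) lo hi"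
proof -
  let ?G = "tri_graph r" and ?h = "folded_level l c" and ?z = "(c, l + 1)"
  let ?e = "{(c + 1, l), ?z}"
  define h where "h = ?h(?z := l + 2)"
  have z: "?z \<in> nodes ?G" "?h ?z = l + 1" "fold_index c ?z = c + l"
    using cl by (auto simp: nodes_tri_graph folded_level_def fold_index_def)
  have lip: "h u \<le> h v + 1" if "{u, v} \<in> edges (delete_edge ?e ?G)" for u v
  proof -
    have uv: "tri_edge r u v \<or> tri_edge r v u" "{u, v} \<noteq> ?e"
      using that by (auto simp: delete_edge_def doubleton_in_edges_tri_graph[symmetric])
    have *: "h u \<le> h v + 1 \<and> h v \<le> h u + 1" if "tri_edge r u v" "{u, v} \<noteq> ?e" for u v
      using that
    proof cases
      case (row i m)
      then show ?thesis using cl by (auto simp: h_def folded_level_def)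
    next
      case (column i m)
      then show ?thesis using cl by (auto simp: h_def folded_level_def)
    next
      case (diagonal i m)
      then show ?thesis using cl that(2) by (auto simp: h_def folded_level_def)
    qed
    have "{v, u} = {u, v}" by blast
    then have "{v, u} \<noteq> ?e" using uv(2) by (rule ssubst)
    then show ?thesis using uv *[of u v] *[of v u] by blast
  qed
  have centre: "fold_index c x \<noteq> c" if "x \<in> nodes ?G" "?h x \<noteq> l + 1" for x
    using fold_index_eq_centre[OF that(1), of c l] that(2) by auto
  have level: "card {x \<in> nodes ?G. h x = t} \<le> r - 1" for t
  proof -
    consider "t = l + 1" | "t = l + 2" | "t \<noteq> l + 1" "t \<noteq> l + 2" by blast
    then show ?thesis
    proof cases
      case 1
      have "fold_index c x \<noteq> c + l" if "x \<in> nodes ?G" "x \<noteq> ?z" "?h x = t" for x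
        using inj_onD[OF inj_on_fold_index[of c r l t], of x ?z] that z 1 by auto
      moreover have "{x \<in> nodes ?G. h x = t} = {x \<in> nodes ?G. x \<noteq> ?z \<and> ?h x = t}"
        using 1 by (auto simp: h_def)
      moreover have "{c + l} \<subseteq> {1..r}" using cl by auto
      ultimately have "card {x \<in> nodes ?G. h x = t} \<le> r - card {c + l}"
        by (intro card_level_less[where J = l and t = t]) blast+
      then show ?thesis by simp
    next
      case 2
      have "fold_index c x \<noteq> c + 1" if "x \<in> nodes ?G" "?h x = t" for x
        using fold_index_eq_next[OF that(1), of c l] that(2) cl(2) 2 by auto
      moreover have "fold_index c x \<noteq> c" if "x \<in> nodes ?G" "?h x = t" for x
        using centre[OF that(1)] that(2) 2 by simp
      moreover have "{c, c + 1} \<subseteq> {1..r}" using cl by auto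
      ultimately have "card {x \<in> nodes ?G. ?h x = t} \<le> r - card {c, c + 1}"
        by (intro card_level_less[where J = l and t = t]) blast+
      then have "card {x \<in> nodes ?G. ?h x = t} \<le> r - 2" by simp
      moreover have "{x \<in> nodes ?G. h x = t} = insert ?z {x \<in> nodes ?G. ?h x = t}"
        using 2 z by (auto simp: h_def)
      ultimately show ?thesis
        using card_insert_le_m1[of "r - 1" "{x \<in> nodes ?G. ?h x = t}" ?z] cl by (simp del: One_nat_def)
    next
      case 3
      then have "{x \<in> nodes ?G. h x = t} = {x \<in> nodes ?G. ?h x = t}"
        using z by (auto simp: h_def)
      moreover have "fold_index c x \<noteq> c" if "x \<in> nodes ?G" "?h x = t" for x
        using centre[OF that(1)] that(2) 3 by simp
      moreover have "{c} \<subseteq> {1..r}" using cl by auto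
      ultimately have "card {x \<in> nodes ?G. h x = t} \<le> r - card {c}"
        by (intro card_level_less[where J = l and t = t]) blast+
      then show ?thesis by simp
    qed
  qed
  have "interval_layout (r - 1) (delete_edge ?e ?G) h h"
    unfolding interval_layout_def
  proof (intro conjI ballI allI impI)
    fix t
    have "{x \<in> nodes (delete_edge ?e ?G). h x \<le> t \<and> t \<le> h x} = {x \<in> nodes ?G. h x = t}"
      by (auto simp: delete_edge_def)
    then show "card {x \<in> nodes (delete_edge ?e ?G). h x \<le> t \<and> t \<le> h x} \<le> r - 1"
      using level by simp
  qed (use lip in auto)
  then show ?thesis by blast
qed

text \<open>The rotation sends row edges to column edges and column edges to diagonal edges.\<close>

lemma layout_delete_edge:
  assumes "e \<in> edges (tri_graph r)"
  shows "\<exists>lo hi. interval_layout (r - 1) (delete_edge e (tri_graph r)) lo hi" (is "?P e")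
proof -
  have along_diagonal: "?P {(i + 1, l), (i, l + 1)}" if "1 \<le> i" "1 \<le> l" "i + l \<le> r" for i l
    using that by (rule layout_delete_diagonal)
  have rot: "?P {u, v}" if "?P {tri_rotate r v, tri_rotate r u}" "tri_edge r u v" for u v
  proof -
    obtain lo hi where "interval_layout (r - 1) (delete_edge {tri_rotate r u, tri_rotate r v} (tri_graph r)) lo hi"
      using \<open>?P {tri_rotate r v, tri_rotate r u}\<close> by (auto simp: insert_commute)
    then show ?thesis
      using layout_delete_rotate \<open>tri_edge r u v\<close> doubleton_in_edges_tri_graph by metis
  qed
  have along_column: "?P {(i, l), (i, l + 1)}" if il: "1 \<le> i" "1 \<le> l" "i + l \<le> r" for i l
  proof -
    obtain i' l' where i': "1 \<le> i'" "1 \<le> l'" "i' + l' \<le> r" and t: "tri_rotate r (i, l) = (i', l' + 1)"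
      "tri_rotate r (i, l + 1) = (i' + 1, l')" using tri_rotate_triangle[OF il] by metis
    show ?thesis
      by (rule rot[OF _ tri_edge.column[OF il]]) (use along_diagonal[OF i'] in \<open>simp only: t\<close>)
  qed
  have along_row: "?P {(i, l), (i + 1, l)}" if il: "1 \<le> i" "1 \<le> l" "i + l \<le> r" for i l
  proof -
    obtain i' l' where i': "1 \<le> i'" "1 \<le> l'" "i' + l' \<le> r" and t: "tri_rotate r (i, l) = (i', l' + 1)"
      "tri_rotate r (i + 1, l) = (i', l')" using tri_rotate_triangle[OF il] by metis
    show ?thesis
      by (rule rot[OF _ tri_edge.row[OF il]]) (use along_column[OF i'] in \<open>simp only: t\<close>)
  qed
  obtain u v where "e = {u, v}" "tri_edge r u v" using assms unfolding edges_tri_graph by blast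
  from this(2) show ?thesis
    unfolding \<open>e = {u, v}\<close> by cases (use along_diagonal along_column along_row in simp_all)
qed

text \<open>The rotation sends column edges to diagonal edges and diagonal edges to row edges.\<close>

lemma layout_contract_edge:
  assumes "{u, v} \<in> edges (tri_graph r)"
  shows "\<exists>lo hi. interval_layout (r - 1) (contract_edge u v (tri_graph r)) lo hi" (is "?P u v")
proof -
  have along_row: "?P u v" if "1 \<le> i" "1 \<le> l" "i + l \<le> r" "{u, v} = {(i, l), (i + 1, l)}" for i l u v
    using that by (rule layout_contract_row)
  have rot: "?P u v" if "?P (tri_rotate r u) (tri_rotate r v)" "{u, v} \<in> edges (tri_graph r)" for u v
    using that layout_contract_rotate by blast
  have along_diagonal: "?P u v" if il: "1 \<le> i" "1 \<le> l" "i + l \<le> r" and uv: "{u, v} = {(i + 1, l), (i, l + 1)}" for i l u v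
  proof -
    obtain i' l' where i': "1 \<le> i'" "1 \<le> l'" "i' + l' \<le> r" and t: "tri_rotate r (i + 1, l) = (i', l')"
      "tri_rotate r (i, l + 1) = (i' + 1, l')" using tri_rotate_triangle[OF il] by metis
    have "tri_rotate r ` {u, v} = {(i', l'), (i' + 1, l')}" unfolding uv image_insert image_empty t by (rule refl insert_commute)
    then have "{tri_rotate r u, tri_rotate r v} = {(i', l'), (i' + 1, l')}" by (simp only: image_insert image_empty)
    then have "?P (tri_rotate r u) (tri_rotate r v)" by (rule along_row[OF i'])
    moreover have "{u, v} \<in> edges (tri_graph r)"
      unfolding uv doubleton_in_edges_tri_graph using tri_edge.diagonal[OF il] by blast
    ultimately show ?thesis by (rule rot)
  qed
  have along_column: "?P u v" if il: "1 \<le> i" "1 \<le> l" "i + l \<le> r" and uv: "{u, v} = {(i, l), (i, l + 1)}" for i l u v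
  proof -
    obtain i' l' where i': "1 \<le> i'" "1 \<le> l'" "i' + l' \<le> r" and t: "tri_rotate r (i, l) = (i', l' + 1)"
      "tri_rotate r (i, l + 1) = (i' + 1, l')" using tri_rotate_triangle[OF il] by metis
    have "tri_rotate r ` {u, v} = {(i' + 1, l'), (i', l' + 1)}" unfolding uv image_insert image_empty t by (rule refl insert_commute)
    then have "{tri_rotate r u, tri_rotate r v} = {(i' + 1, l'), (i', l' + 1)}" by (simp only: image_insert image_empty)
    then have "?P (tri_rotate r u) (tri_rotate r v)" by (rule along_diagonal[OF i'])
    moreover have "{u, v} \<in> edges (tri_graph r)"
      unfolding uv doubleton_in_edges_tri_graph using tri_edge.column[OF il] by blast
    ultimately show ?thesis by (rule rot)
  qed
  obtain x y where xy: "{u, v} = {x, y}" "tri_edge r x y" using assms unfolding edges_tri_graph by blast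
  from xy(2) show ?thesis
  proof cases
    case (row i l)
    with xy(1) show ?thesis by (intro along_row[of i l]) simp_all
  next
    case (column i l)
    with xy(1) show ?thesis by (intro along_column[of i l]) simp_all
  next
    case (diagonal i l)
    with xy(1) show ?thesis by (intro along_diagonal[of i l]) simp_all
  qed
qed

text \<open>Every node lies on an edge, so deleting a node leaves a subgraph of some edge-deleted grid.\<close>

lemma tri_graph_minor_step_layout:
  assumes "2 \<le> r" "minor_step (tri_graph r) H"
  shows "\<exists>lo hi. interval_layout (r - 1) H lo hi"
  using assms(2)
proof cases
  case (edge_deletion e)
  then show ?thesis using layout_delete_edge by simp
next
  case (edge_contraction u v)
  then show ?thesis using layout_contract_edge by simp
next
  case (node_deletion v)
  obtain i l where il: "v = (i, l)" "1 \<le> i" "1 \<le> l" "i + l \<le> r + 1"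
    using node_deletion(2) by (cases v) (auto simp: nodes_tri_graph)
  have "\<exists>e \<in> edges (tri_graph r). v \<in> e"
  proof (cases "i + l \<le> r")
    case True
    then have "{(i, l), (i + 1, l)} \<in> edges (tri_graph r)"
      unfolding doubleton_in_edges_tri_graph using tri_edge.row il by blast
    then show ?thesis using il(1) by blast
  next
    case False
    show ?thesis
    proof (cases "i = 1")
      case True
      then have "{(1, l - 1), (1, l - 1 + 1)} \<in> edges (tri_graph r)"
        unfolding doubleton_in_edges_tri_graph using tri_edge.column[of 1 "l - 1" r] il False assms(1) by auto
      moreover have "v = (1, l - 1 + 1)" using True il False assms(1) by simp
      ultimately show ?thesis by blast
    next
      case i: False
      then have "{(i - 1, l), (i - 1 + 1, l)} \<in> edges (tri_graph r)"
        unfolding doubleton_in_edges_tri_graph using tri_edge.row[of "i - 1" l r] il by auto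
      moreover have "v = (i - 1 + 1, l)" using i il by simp
      ultimately show ?thesis by blast
    qed
  qed
  then obtain e where e: "e \<in> edges (tri_graph r)" "v \<in> e" by blast
  obtain lo hi where "interval_layout (r - 1) (delete_edge e (tri_graph r)) lo hi"
    using layout_delete_edge[OF e(1)] by blast
  then have "interval_layout (r - 1) H (lo \<circ> id) (hi \<circ> id)"
    unfolding node_deletion(1) using e(2) simple_tri_graph[of r]
    by (intro interval_layout_pullback[of "r - 1" "delete_edge e (tri_graph r)"])
      (auto simp: delete_edge_def delete_node_def simple_graph_def)
  then show ?thesis by blast
qed

section \<open>An objective with a rigid optimum\<close>

text \<open>The matrix \<open>\<Sum>\<^sub>t y\<^sub>t y\<^sub>t\<^sup>T\<close> is supported on the diagonal and the edges. On feasible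
  matrices the diagonal contributes a constant, so maximising the objective with the negated
  off-diagonal entries as weights means minimising the sum of squares.\<close>

lemma clique_squares_objective:
  assumes G: "simple_graph G" and "finite I"
    and y: "\<And>t u v. t \<in> I \<Longrightarrow> y t u \<noteq> 0 \<Longrightarrow> y t v \<noteq> 0 \<Longrightarrow> u \<noteq> v \<Longrightarrow> {u, v} \<in> edges G"
  obtains w k where "\<And>X. sdp_feasible G X \<Longrightarrow>
    (\<Sum>t\<in>I. form (nodes G) X (y t) (y t)) = k - 2 * sdp_objective G w X"
proof -
  let ?V = "nodes G"
  let ?arcs = "{(u, v). {u, v} \<in> edges G}"
  let ?diag = "(\<lambda>u. (u, u)) ` ?V"
  have fin: "finite ?V" using G by (simp add: simple_graph_def)
  define M where "M u v = (\<Sum>t\<in>I. y t u * y t v)" for u v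
  have Msym: "M u v = M v u" for u v unfolding M_def by (simp add: mult.commute)
  \<comment> \<open>A weight is a function of the unordered edge; the choice of its ends is immaterial as \<open>M\<close> is symmetric.\<close>
  define w where "w e = - (SOME m. \<exists>u v. e = {u, v} \<and> m = M u v)" for e
  have w: "w {u, v} = - M u v" for u v
  proof -
    have "\<exists>u' v'. {u, v} = {u', v'} \<and> (SOME m. \<exists>u' v'. {u, v} = {u', v'} \<and> m = M u' v') = M u' v'"
      by (rule someI_ex) blast
    then have "(SOME m. \<exists>u' v'. {u, v} = {u', v'} \<and> m = M u' v') = M u v"
      using Msym by (auto simp: doubleton_eq_iff)
    then show ?thesis by (simp add: w_def)
  qed
  have M0: "M u v = 0" if "u \<noteq> v" "{u, v} \<notin> edges G" for u v
    unfolding M_def using y that by (intro sum.neutral) auto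
  show thesis
  proof (rule that)
    fix X assume X: "sdp_feasible G X"
    have "(\<Sum>t\<in>I. form ?V X (y t) (y t)) = (\<Sum>u\<in>?V. \<Sum>t\<in>I. \<Sum>v\<in>?V. y t u * X u v * y t v)"
      unfolding form_def by (rule sum.swap)
    also have "\<dots> = (\<Sum>u\<in>?V. \<Sum>v\<in>?V. \<Sum>t\<in>I. y t u * X u v * y t v)"
      by (intro sum.cong refl sum.swap)
    also have "\<dots> = (\<Sum>u\<in>?V. \<Sum>v\<in>?V. M u v * X u v)"
      unfolding M_def sum_distrib_right by (intro sum.cong refl) (simp add: mult_ac)
    also have "\<dots> = (\<Sum>(u, v)\<in>?V \<times> ?V. M u v * X u v)" by (rule sum.cartesian_product)
    also have "\<dots> = (\<Sum>(u, v)\<in>?diag \<union> ?arcs. M u v * X u v)"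
    proof (rule sum.mono_neutral_right)
      show "finite (?V \<times> ?V)" using fin by simp
      show "?diag \<union> ?arcs \<subseteq> ?V \<times> ?V" using edge_subset_nodes[OF G] by auto
      have "M u v * X u v = 0" if "u \<in> ?V" "(u, v) \<notin> ?diag \<union> ?arcs" for u v
        using that M0[of u v] by (cases "u = v") auto
      note zero = this
      show "\<forall>p \<in> ?V \<times> ?V - (?diag \<union> ?arcs). (case p of (u, v) \<Rightarrow> M u v * X u v) = 0"
      proof
        fix p assume p: "p \<in> ?V \<times> ?V - (?diag \<union> ?arcs)"
        obtain u v where uv: "p = (u, v)" by (cases p)
        show "(case p of (u, v) \<Rightarrow> M u v * X u v) = 0"
          using p zero[of u v] unfolding uv prod.case by blast
      qed
    qed
    also have "\<dots> = (\<Sum>(u, v)\<in>?diag. M u v * X u v) + (\<Sum>(u, v)\<in>?arcs. M u v * X u v)"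
      using fin finite_arcs[OF G] G by (intro sum.union_disjoint) (auto simp: simple_graph_def)
    also have "(\<Sum>(u, v)\<in>?diag. M u v * X u v) = (\<Sum>u\<in>?V. M u u)"
      using X by (subst sum.reindex) (auto simp: inj_on_def sdp_feasible_def)
    also have "(\<Sum>(u, v)\<in>?arcs. M u v * X u v) = - 2 * sdp_objective G w X"
      unfolding sdp_objective_def by (simp add: w sum_negf case_prod_unfold)
    finally show "(\<Sum>t\<in>I. form ?V X (y t) (y t)) = (\<Sum>u\<in>?V. M u u) - 2 * sdp_objective G w X" by simp
  qed
qed

lemma form_gram:
  "form V (\<lambda>u v. \<Sum>k\<in>K. g u k * g v k) x y = (\<Sum>k\<in>K. (\<Sum>u\<in>V. x u * g u k) * (\<Sum>v\<in>V. y v * g v k))"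
proof -
  have "form V (\<lambda>u v. \<Sum>k\<in>K. g u k * g v k) x y = (\<Sum>u\<in>V. \<Sum>v\<in>V. \<Sum>k\<in>K. (x u * g u k) * (y v * g v k))"
    unfolding form_def sum_distrib_left sum_distrib_right by (intro sum.cong refl) (simp add: mult_ac)
  also have "\<dots> = (\<Sum>u\<in>V. \<Sum>k\<in>K. \<Sum>v\<in>V. (x u * g u k) * (y v * g v k))"
    by (intro sum.cong refl sum.swap)
  also have "\<dots> = (\<Sum>k\<in>K. \<Sum>u\<in>V. \<Sum>v\<in>V. (x u * g u k) * (y v * g v k))" by (rule sum.swap)
  also have "\<dots> = (\<Sum>k\<in>K. (\<Sum>u\<in>V. x u * g u k) * (\<Sum>v\<in>V. y v * g v k))"
    by (simp only: sum_product)
  finally show ?thesis .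
qed

lemma psd_gram: "psd V (\<lambda>u v. \<Sum>k\<in>K. g u k * g v k)"
  unfolding psd_def
proof (intro conjI ballI allI)
  fix x :: "'a \<Rightarrow> real"
  show "0 \<le> (\<Sum>i\<in>V. \<Sum>j\<in>V. x i * (\<Sum>k\<in>K. g i k * g j k) * x j)"
    using form_gram[of V g K x x] by (simp add: form_def sum_nonneg)
qed (simp add: mult.commute)

lemma binomial_sum_Suc:
  fixes x :: "nat \<Rightarrow> real"
  shows "(\<Sum>k\<le>q. (q choose k) * x k) + (\<Sum>k\<le>q. (q choose k) * x (Suc k)) = (\<Sum>k\<le>Suc q. (Suc q choose k) * x k)"
proof -
  have "(\<Sum>k\<le>q. (q choose k) * x k) = (\<Sum>k\<le>Suc q. (q choose k) * x k)" by simp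
  also have "\<dots> = x 0 + (\<Sum>k\<le>q. (q choose Suc k) * x (Suc k))"
    by (subst sum.atMost_Suc_shift) simp
  finally have 1: "(\<Sum>k\<le>q. (q choose k) * x k) = x 0 + (\<Sum>k\<le>q. (q choose Suc k) * x (Suc k))" .
  have "(\<Sum>k\<le>Suc q. (Suc q choose k) * x k) = x 0 + (\<Sum>k\<le>q. (Suc q choose Suc k) * x (Suc k))"
    by (subst sum.atMost_Suc_shift) simp
  then show ?thesis unfolding 1 by (simp add: sum.distrib algebra_simps)
qed

text \<open>The optimal Gram vectors start from an orthonormal bottom row; the vector above two neighbours is the
  normalised sum of their vectors. The vector of \<open>(i, q + 1)\<close> is then the \<open>q\<close>-th row of Pascal's triangle,
  placed from coordinate \<open>i\<close> on and divided by its norm \<open>binomial_norm q\<close>.\<close>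

definition binomial_norm :: "nat \<Rightarrow> real" where
  "binomial_norm q = sqrt (\<Sum>k\<le>q. (real (q choose k))\<^sup>2)"

lemma binomial_norm_square: "(binomial_norm q)\<^sup>2 = (\<Sum>k\<le>q. (real (q choose k))\<^sup>2)"
  unfolding binomial_norm_def by (simp add: sum_nonneg)

lemma binomial_norm_pos: "0 < binomial_norm q"
proof -
  have "(real (q choose 0))\<^sup>2 \<le> (\<Sum>k\<le>q. (real (q choose k))\<^sup>2)"
    by (rule member_le_sum) auto
  then show ?thesis unfolding binomial_norm_def by simp
qed

text \<open>The linear relation between the Gram vectors of the triangle with bottom edge
  \<open>{(i, q + 1), (i + 1, q + 1)}\<close> and top \<open>(i, q + 2)\<close>.\<close>

definition triangle_relation :: "nat \<times> nat \<Rightarrow> nat \<times> nat \<Rightarrow> real" where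
  "triangle_relation = (\<lambda>(i, q) v. binomial_norm (Suc q) * of_bool (v = (i, Suc (Suc q)))
     - binomial_norm q * of_bool (v = (i, Suc q)) - binomial_norm q * of_bool (v = (Suc i, Suc q)))"

definition up_triangles :: "nat \<Rightarrow> (nat \<times> nat) set" where
  "up_triangles r = {(i, q). 1 \<le> i \<and> i + q < r}"

lemma finite_up_triangles: "finite (up_triangles r)"
  by (rule finite_subset[of _ "{..r} \<times> {..r}"]) (auto simp: up_triangles_def)

lemma triangle_relation_clique:
  assumes "t \<in> up_triangles r" "triangle_relation t u \<noteq> 0" "triangle_relation t v \<noteq> 0" "u \<noteq> v"
  shows "{u, v} \<in> edges (tri_graph r)"
proof -
  obtain i q where t: "t = (i, q)" "1 \<le> i" "1 \<le> Suc q" "i + Suc q \<le> r"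
    using assms(1) by (auto simp: up_triangles_def)
  have "u \<in> {(i, Suc (Suc q)), (i, Suc q), (Suc i, Suc q)}" "v \<in> {(i, Suc (Suc q)), (i, Suc q), (Suc i, Suc q)}"
    using assms(2,3) by (auto simp: t(1) triangle_relation_def split: if_splits)
  then show ?thesis
    unfolding doubleton_in_edges_tri_graph using assms(4) tri_edge.intros[OF t(2-4)] by auto
qed

definition grid_vector :: "nat \<times> nat \<Rightarrow> nat \<Rightarrow> real" where
  "grid_vector = (\<lambda>(i, l) k. (if i \<le> k then real ((l - 1) choose (k - i)) else 0) / binomial_norm (l - 1))"

lemma grid_vector_step:
  "binomial_norm (Suc q) * grid_vector (i, Suc (Suc q)) k
    = binomial_norm q * grid_vector (i, Suc q) k + binomial_norm q * grid_vector (Suc i, Suc q) k"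
proof -
  have pos: "binomial_norm q \<noteq> 0" "binomial_norm (Suc q) \<noteq> 0" using binomial_norm_pos by (simp_all add: less_imp_neq[THEN not_sym])
  consider "k < i" | "k = i" | m where "k = i + Suc m"
    by (cases rule: linorder_cases[of k i]) (auto dest!: less_imp_Suc_add)
  then show ?thesis by cases (simp_all add: grid_vector_def pos)
qed

lemma grid_vector_unit:
  assumes "1 \<le> i" "1 \<le> l" "i + l \<le> r + 1"
  shows "(\<Sum>k\<in>{1..r}. grid_vector (i, l) k * grid_vector (i, l) k) = 1"
proof -
  obtain q where q: "l = Suc q" using assms(2) by (cases l) auto
  let ?f = "\<lambda>k. (if i \<le> k then real (q choose (k - i)) else 0)\<^sup>2"
  have "(\<Sum>k\<in>{1..r}. ?f k) = (\<Sum>k\<in>{0 + i..<Suc q + i}. ?f k)"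
    using assms q by (intro sum.mono_neutral_right) auto
  also have "\<dots> = (binomial_norm q)\<^sup>2"
    unfolding sum.shift_bounds_nat_ivl binomial_norm_square by (simp add: atLeast0LessThan lessThan_Suc_atMost)
  finally have "(\<Sum>k\<in>{1..r}. ?f k / (binomial_norm q)\<^sup>2) = 1"
    using binomial_norm_pos[of q] by (simp add: sum_divide_distrib[symmetric])
  then show ?thesis
    by (simp add: grid_vector_def q power_divide[symmetric] power2_eq_square cong: if_cong)
qed

definition grid_gram :: "nat \<Rightarrow> nat \<times> nat \<Rightarrow> nat \<times> nat \<Rightarrow> real" where
  "grid_gram r u v = (\<Sum>k\<in>{1..r}. grid_vector u k * grid_vector v k)"

lemma grid_gram_feasible: "sdp_feasible (tri_graph r) (grid_gram r)"
  unfolding sdp_feasible_def grid_gram_def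
  using psd_gram grid_vector_unit by (auto simp: nodes_tri_graph)

lemma triangle_relation_form_left:
  assumes "(i, q) \<in> up_triangles r" "u \<in> nodes (tri_graph r)"
  shows "form (nodes (tri_graph r)) X (\<lambda>k. of_bool (k = u)) (triangle_relation (i, q))
    = binomial_norm (Suc q) * X u (i, Suc (Suc q)) - binomial_norm q * X u (i, Suc q) - binomial_norm q * X u (Suc i, Suc q)"
proof -
  have fin: "finite (nodes (tri_graph r))" using simple_tri_graph by (simp add: simple_graph_def)
  have n: "(i, Suc (Suc q)) \<in> nodes (tri_graph r)" "(i, Suc q) \<in> nodes (tri_graph r)" "(Suc i, Suc q) \<in> nodes (tri_graph r)"
    using assms(1) by (auto simp: nodes_tri_graph up_triangles_def)
  show ?thesis
    unfolding triangle_relation_def prod.case form_linear form_unit[OF fin assms(2) n(1)]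
      form_unit[OF fin assms(2) n(2)] form_unit[OF fin assms(2) n(3)] ..
qed

lemma grid_gram_triangle_relation:
  assumes "t \<in> up_triangles r"
  shows "form (nodes (tri_graph r)) (grid_gram r) (triangle_relation t) (triangle_relation t) = 0"
proof -
  let ?V = "nodes (tri_graph r)"
  obtain i q where t: "t = (i, q)" "1 \<le> i" "i + q < r"
    using assms by (auto simp: up_triangles_def)
  have fin: "finite ?V" using simple_tri_graph by (simp add: simple_graph_def)
  have n: "(i, Suc (Suc q)) \<in> ?V" "(i, Suc q) \<in> ?V" "(Suc i, Suc q) \<in> ?V"
    using t by (auto simp: nodes_tri_graph)
  have pick: "(\<Sum>v\<in>?V. c * of_bool (v = a) * grid_vector v k) = c * grid_vector a k" if "a \<in> ?V" for a c k
  proof -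
    have "(\<Sum>v\<in>?V. c * of_bool (v = a) * grid_vector v k) = (\<Sum>v\<in>?V. if v = a then c * grid_vector a k else 0)"
      by (intro sum.cong) auto
    then show ?thesis using fin that by simp
  qed
  have "(\<Sum>v\<in>?V. triangle_relation t v * grid_vector v k) = 0" for k
    unfolding t(1) triangle_relation_def prod.case left_diff_distrib sum_subtractf pick[OF n(1)] pick[OF n(2)] pick[OF n(3)]
    using grid_vector_step[of q i k] by simp
  then show ?thesis
    using form_gram[of ?V grid_vector "{1..r}" "triangle_relation t" "triangle_relation t"]
    unfolding grid_gram_def[abs_def] by simp
qed

text \<open>The relations express the vector of \<open>(i, d + 1)\<close> as the binomial combination of
  \<open>(i, 1), \<dots>, (i + d, 1)\<close> divided by \<open>binomial_norm d\<close>. Its norm is \<open>1\<close>. By induction on the distance,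
  all inner products between these bottom vectors vanish except possibly the one between the two outermost,
  and comparing norms shows that this one vanishes too.\<close>

lemma triangle_relations_force_orthogonality:
  assumes X: "sdp_feasible (tri_graph r) X"
    and ker: "\<And>t. t \<in> up_triangles r \<Longrightarrow>
      form (nodes (tri_graph r)) X (triangle_relation t) (triangle_relation t) = 0"
    and i: "1 \<le> i" and d: "1 \<le> d" and id: "i + d \<le> r"
  shows "X (i, 1) (i + d, 1) = 0"
proof -
  let ?V = "nodes (tri_graph r)" and ?N = binomial_norm
  have psd: "psd ?V X" and one: "\<And>v. v \<in> ?V \<Longrightarrow> X v v = 1" and sym: "\<And>u v. u \<in> ?V \<Longrightarrow> v \<in> ?V \<Longrightarrow> X u v = X v u"
    using X by (auto simp: sdp_feasible_def psd_def)
  have base: "(j, 1) \<in> ?V" if "1 \<le> j" "j \<le> r" for j using that by (auto simp: nodes_tri_graph)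
  have step: "?N (Suc q) * X u (i, Suc (Suc q)) = ?N q * X u (i, Suc q) + ?N q * X u (Suc i, Suc q)"
    if "1 \<le> i" "i + q < r" "u \<in> ?V" for i q u
  proof -
    have t: "(i, q) \<in> up_triangles r" using that by (simp add: up_triangles_def)
    show ?thesis
      using psd_isotropic_in_kernel(2)[OF psd ker[OF t]] triangle_relation_form_left[OF t that(3), of X] by simp
  qed
  have expand: "?N q * X u (i, Suc q) = (\<Sum>k\<le>q. (q choose k) * X u (i + k, 1))"
    if "1 \<le> i" "i + q \<le> r" "u \<in> ?V" for i q u
    using that
  proof (induction q arbitrary: i)
    case 0
    then show ?case by (simp add: binomial_norm_def)
  next
    case (Suc q)
    have "?N (Suc q) * X u (i, Suc (Suc q)) = ?N q * X u (i, Suc q) + ?N q * X u (Suc i, Suc q)"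
      using Suc.prems by (intro step) auto
    also have "\<dots> = (\<Sum>k\<le>q. (q choose k) * X u (i + k, 1)) + (\<Sum>k\<le>q. (q choose k) * X u (i + Suc k, 1))"
      using Suc.IH[of i] Suc.IH[of "Suc i"] Suc.prems by simp
    also have "\<dots> = (\<Sum>k\<le>Suc q. (Suc q choose k) * X u (i + k, 1))"
      by (rule binomial_sum_Suc)
    finally show ?case .
  qed
  show ?thesis
    using i d id
  proof (induction d arbitrary: i rule: less_induct)
    case (less d)
    let ?C = "\<lambda>k. real (d choose k)"
    \<comment> \<open>The inner product between the outermost vectors.\<close>
    define a where "a = X (i, 1) (i + d, 1)"
    let ?p = "(i, Suc d)"
    have p: "?p \<in> ?V" using less.prems by (auto simp: nodes_tri_graph)
    have b: "(i + k, 1) \<in> ?V" if "k \<le> d" for k using less.prems that by (intro base) auto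
    have entry: "X (i + k, 1) (i + j, 1) = of_bool (j = k) + a * (of_bool (k = 0 \<and> j = d) + of_bool (k = d \<and> j = 0))"
      if kj: "k \<le> d" "j \<le> d" for k j
    proof -
      have ordered: "X (i + k, 1) (i + j, 1) = (if k = 0 \<and> j = d then a else 0)" if "k < j" "j \<le> d" for k j
      proof (cases "k = 0 \<and> j = d")
        case False
        then have "X (i + k, 1) (i + k + (j - k), 1) = 0"
          using that less.prems by (intro less.IH) auto
        then show ?thesis using that False by auto
      qed (simp add: a_def)
      consider "k = j" | "k < j" | "j < k" by linarith
      then show ?thesis
      proof cases
        case 1
        then show ?thesis using one[OF b[OF kj(1)]] less.prems by auto
      next
        case 2
        then show ?thesis using ordered[OF 2 kj(2)] by auto
      next
        case 3
        then show ?thesis using ordered[OF 3 kj(1)] sym[OF b[OF kj(1)] b[OF kj(2)]] by auto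
      qed
    qed
    have "(?N d)\<^sup>2 = ?N d * (?N d * X ?p ?p)" using one[OF p] by (simp add: power2_eq_square)
    also have "?N d * X ?p ?p = (\<Sum>k\<le>d. ?C k * X ?p (i + k, 1))"
      using less.prems p by (intro expand) auto
    also have "?N d * \<dots> = (\<Sum>k\<le>d. ?C k * (?N d * X (i + k, 1) ?p))"
      unfolding sum_distrib_left
    proof (intro sum.cong refl)
      fix k assume "k \<in> {..d}"
      then show "?N d * (?C k * X ?p (i + k, 1)) = ?C k * (?N d * X (i + k, 1) ?p)"
        using sym[OF p b[of k]] by simp
    qed
    also have "\<dots> = (\<Sum>k\<le>d. ?C k * (\<Sum>j\<le>d. ?C j * X (i + k, 1) (i + j, 1)))"
      using less.prems by (intro sum.cong refl arg_cong2[of _ _ _ _ "(*)"] expand b) auto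
    also have "\<dots> = (\<Sum>k\<le>d. ?C k * (?C k + a * (of_bool (k = 0) + of_bool (k = d))))"
    proof (intro sum.cong refl arg_cong2[of _ _ _ _ "(*)"])
      fix k assume k: "k \<in> {..d}"
      have "(\<Sum>j\<le>d. ?C j * X (i + k, 1) (i + j, 1))
        = (\<Sum>j\<le>d. (if j = k then ?C k else 0) + (if j = d then a * of_bool (k = 0) else 0) + (if j = 0 then a * of_bool (k = d) else 0))"
      proof (intro sum.cong refl)
        fix j assume "j \<in> {..d}"
        then have kj: "k \<le> d" "j \<le> d" using k by auto
        show "?C j * X (i + k, 1) (i + j, 1) = (if j = k then ?C k else 0)
            + (if j = d then a * of_bool (k = 0) else 0) + (if j = 0 then a * of_bool (k = d) else 0)"
          unfolding entry[OF kj] using less.prems(2) by (auto simp: distrib_left)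
      qed
      also have "\<dots> = ?C k + a * (of_bool (k = 0) + of_bool (k = d))"
        using k unfolding sum.distrib by (simp add: distrib_left)
      finally show "(\<Sum>j\<le>d. ?C j * X (i + k, 1) (i + j, 1)) = ?C k + a * (of_bool (k = 0) + of_bool (k = d))" .
    qed
    also have "\<dots> = (\<Sum>k\<le>d. (?C k)\<^sup>2 + (if k = 0 then a else 0) + (if k = d then a else 0))"
      using less.prems by (intro sum.cong refl) (auto simp: power2_eq_square algebra_simps)
    also have "\<dots> = (?N d)\<^sup>2 + 2 * a"
      unfolding sum.distrib binomial_norm_square by simp
    finally show ?case by (simp add: a_def)
  qed
qed

text \<open>The sum of squares of the triangle relations attains its minimum \<open>0\<close> at \<open>grid_gram r\<close>, so it
  vanishes at every optimum, whose bottom row is therefore orthonormal.\<close>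

lemma tri_graph_rigid_objective:
  obtains w where "\<And>X. sdp_optimal (tri_graph r) w X \<Longrightarrow> r \<le> matrix_rank (nodes (tri_graph r)) X"
proof -
  let ?G = "tri_graph r"
  let ?V = "nodes ?G"
  have fin: "finite ?V" using simple_tri_graph by (simp add: simple_graph_def)
  obtain w k where w: "\<And>X. sdp_feasible ?G X \<Longrightarrow>
      (\<Sum>t\<in>up_triangles r. form ?V X (triangle_relation t) (triangle_relation t)) = k - 2 * sdp_objective ?G w X"
  proof (rule clique_squares_objective[OF simple_tri_graph[of r] finite_up_triangles[of r],
      where y = triangle_relation])
    fix t u v
    assume "t \<in> up_triangles r" "triangle_relation t u \<noteq> 0" "triangle_relation t v \<noteq> 0" "u \<noteq> v"
    then show "{u, v} \<in> edges (tri_graph r)" by (rule triangle_relation_clique)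
  qed (rule that)
  show thesis
  proof (rule that)
    fix X assume opt: "sdp_optimal ?G w X"
    then have X: "sdp_feasible ?G X" by (simp add: sdp_optimal_def)
    then have psd: "psd ?V X" by (simp add: sdp_feasible_def)
    have nn: "0 \<le> form ?V X (triangle_relation t) (triangle_relation t)" for t
      by (rule psd_form_nonneg[OF psd])
    have "(\<Sum>t\<in>up_triangles r. form ?V X (triangle_relation t) (triangle_relation t))
        \<le> (\<Sum>t\<in>up_triangles r. form ?V (grid_gram r) (triangle_relation t) (triangle_relation t))"
      using opt grid_gram_feasible[of r] unfolding w[OF X] w[OF grid_gram_feasible] by (simp add: sdp_optimal_def)
    also have "\<dots> = 0" by (simp add: grid_gram_triangle_relation)
    finally have "(\<Sum>t\<in>up_triangles r. form ?V X (triangle_relation t) (triangle_relation t)) = 0"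
      using nn by (simp add: antisym sum_nonneg)
    then have ker: "form ?V X (triangle_relation t) (triangle_relation t) = 0" if "t \<in> up_triangles r" for t
      using that nn finite_up_triangles by (simp add: sum_nonneg_eq_0_iff)
    let ?B = "(\<lambda>j. (j, 1 :: nat)) ` {1..r}"
    have B: "?B \<subseteq> ?V" by (auto simp: nodes_tri_graph)
    have upper: "X (i, 1) (j, 1) = 0" if "1 \<le> i" "i < j" "j \<le> r" for i j
      using triangle_relations_force_orthogonality[OF X ker that(1), of "j - i"] that by simp
    have sym: "X u v = X v u" if "u \<in> ?V" "v \<in> ?V" for u v using psd that by (simp add: psd_def)
    have off: "X u v = 0" if uv: "u \<in> ?B" "v \<in> ?B" "u \<noteq> v" for u v
    proof -
      obtain i where i: "u = (i, 1)" "1 \<le> i" "i \<le> r" using uv(1) by auto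
      obtain j where j: "v = (j, 1)" "1 \<le> j" "j \<le> r" using uv(2) by auto
      have "X u v = X v u" using uv(1,2) B by (intro sym) blast+
      moreover have "i < j \<or> j < i" using uv(3) i(1) j(1) by auto
      ultimately show ?thesis
        using upper[of i j] upper[of j i] i j by auto
    qed
    have diag: "X b b \<noteq> 0" if "b \<in> ?B" for b
      using X B that by (auto simp: sdp_feasible_def)
    have "card ?B \<le> matrix_rank ?V X" by (rule orthogonal_block_rank[OF fin B diag off])
    then show "r \<le> matrix_rank ?V X" by (simp add: card_image inj_on_def)
  qed
qed

section \<open>The extreme Gram dimension of the triangular grid\<close>

lemma egd_tri_graph:
  assumes "1 \<le> r"
  shows "egd (tri_graph r) = r"
proof (rule antisym)
  show "egd (tri_graph r) \<le> r"
    by (rule interval_layout_egd_le[OF simple_tri_graph tri_graph_row_layout assms])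
next
  let ?P = "\<lambda>s. 1 \<le> s \<and> (\<forall>w. \<exists>X. sdp_optimal (tri_graph r) w X \<and> matrix_rank (nodes (tri_graph r)) X \<le> s)"
  have "?P r" using interval_layout_optimal[OF simple_tri_graph tri_graph_row_layout] assms by blast
  then have "?P (egd (tri_graph r))" unfolding egd_def by (rule LeastI)
  moreover obtain w where "\<And>X. sdp_optimal (tri_graph r) w X \<Longrightarrow> r \<le> matrix_rank (nodes (tri_graph r)) X"
    by (rule tri_graph_rigid_objective[of r]) blast
  ultimately show "r \<le> egd (tri_graph r)" by (meson order_trans)
qed

theorem theorem4p5:
  fixes r :: nat
  assumes "2 \<le> r"
  shows "egd (tri_graph r) = r \<and>
    minimal_forbidden_minor (egd_class (r - 1)) (tri_graph r)"
proof
  show egd: "egd (tri_graph r) = r" using egd_tri_graph assms by simp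
  have "H \<in> egd_class (r - 1)" if H: "proper_minor H (tri_graph r)" for H
  proof -
    have "simple_graph H \<and> (\<exists>lo hi. interval_layout (r - 1) H lo hi)"
      using simple_tri_graph tri_graph_minor_step_layout[OF assms] H by (rule proper_minors_layout)
    then show ?thesis
      using interval_layout_egd_le[of H "r - 1"] assms by (auto simp: egd_class_def)
  qed
  then show "minimal_forbidden_minor (egd_class (r - 1)) (tri_graph r)"
    using simple_tri_graph egd assms by (auto simp: minimal_forbidden_minor_def egd_class_def)
qed

end
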